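(* Let $P^*\succeq0$ be the stabilizing solution of the generalized algebraic Riccati equation $$PA+A^\top P+A_1^\top PA_1-PBR^{-1}B^\top P+\gamma^{-2}PEE^\top P+Q=0.$$ For any $\varepsilon_0\in(0,1)$ there exist $\delta_0=\delta_0(\varepsilon_0)>0$ and $k_0=k_0(\delta_0)>0$ such that for any $i\in\mathbb Z_{\ge0}$ and any $P^i\in\mathcal B_{\delta_0}(P^* ):=\{P\in\mathcal S^n_+ : \|P-P^*\|_F\le\delta_0\}$ the following hold. (i) $\sigma(\mathscr L_{\overline A^i,A_1})\subset\mathbb C_-$, where $\overline A^i=A-BR^{-1}B^\top P^i+\gamma^{-2}EE^\top P^i$. (ii) The model-based simultaneous policy update algorithm has a local quadratic convergence rate: if $P^{i+1}$ is the solution of $$P^{i+1}\overline A^i+(\overline A^i)^\top P^{i+1}+A_1^\top P^{i+1}A_1+Q+P^iBR^{-1}B^\top P^i-\gamma^{-2}P^iEE^\top P^i=0,$$ then $\|P^{i+1}-P^*\|_F\le k_0\|P^i-P^*\|_F^2$. Especially, $\|P^{i+1}-P^*\|_F\le\varepsilon_0\|P^i-P^*\|_F$.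
   Context: $\mathcal S^n$ ($\mathcal S^n_+$) is the set of real symmetric (symmetric positive semidefinite) $n\times n$ matrices; $\|\cdot\|_F$ is the Frobenius norm; $\mathbb C_-$ is the open left half of the complex plane. $A,A_1\in\mathbb R^{n\times n}$, $B\in\mathbb R^{n\times m}$, $E\in\mathbb R^{n\times p}$, $C$, $D$ are constant real matrices, $D$ has full column rank, $Q=C^\top C$, $R=D^\top D$ (positive definite), $\gamma>0$. For $M\in\mathbb R^{n\times n}$, the generalized Lyapunov operator is $\mathscr L_{M,A_1}(X)=XM+M^\top X+A_1^\top XA_1$ and $\sigma(\mathscr L_{M,A_1})=\{\lambda : \mathscr L_{M,A_1}(X)=\lambda X,\ X\ne0,\ X\in\mathcal S^n\}$. The system $dx=Mx\,dt+A_1x\,dW$ ($W$ a one-dimensional standard Brownian motion) is asymptotically mean square stable (i.e. $\mathbb E\|x(t)\|^2\to0$ for every deterministic $x(0)$) if and only if $\sigma(\mathscr L_{M,A_1})\subset\mathbb C_-$. A solution $P\succeq0$ of the Riccati equation is stabilizing if $dx=(A-BR^{-1}B^\top P+\gamma^{-2}EE^\top P)x\,dt+A_1x\,dW$ is asymptotically mean square stable. *)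

theory Defs
  imports "HOL-Probability.Probability"
begin

section \<open>Matrices\<close>

text \<open>
  The library norm on \<^typ>\<open>real^'n^'m\<close> is the Euclidean norm of the Euclidean norms of the rows,
  that is, the Frobenius norm.
\<close>

definition psd :: "real^'n^'n \<Rightarrow> bool" where
  "psd P \<longleftrightarrow> transpose P = P \<and> (\<forall>x. 0 \<le> x \<bullet> (P *v x))"

definition psd_ball :: "real \<Rightarrow> real^'n^'n \<Rightarrow> (real^'n^'n) set" where
  "psd_ball \<delta> P\<^sub>0 = {P. psd P \<and> norm (P - P\<^sub>0) \<le> \<delta>}"

definition glyap :: "'a::comm_ring_1^'n^'n \<Rightarrow> 'a^'n^'n \<Rightarrow> 'a^'n^'n \<Rightarrow> 'a^'n^'n" where
  "glyap M A\<^sub>1 X = X ** M + transpose M ** X + transpose A\<^sub>1 ** X ** A\<^sub>1"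

text \<open>
  The spectrum of \<^term>\<open>glyap M A\<^sub>1\<close> as a linear operator on the real vector space of symmetric
  matrices. Its eigenvalues are complex, so eigenvectors range over the complexification of that
  space, which consists of the complex symmetric (\<open>X\<^sup>T = X\<close>, not Hermitian) matrices. Real
  eigenvectors alone would only give the real eigenvalues.
\<close>

definition glyap_spectrum :: "real^'n^'n \<Rightarrow> real^'n^'n \<Rightarrow> complex set" where
  "glyap_spectrum M A\<^sub>1 =
     {\<mu>. \<exists>X::complex^'n^'n. X \<noteq> 0 \<and> transpose X = X \<and>
        glyap (map_matrix of_real M) (map_matrix of_real A\<^sub>1) X = map_matrix (\<lambda>z. \<mu> * z) X}"

definition open_left_half_plane :: "complex set" where
  "open_left_half_plane = {z. Re z < 0}"

definition closed_loop ::
  "real^'n^'n \<Rightarrow> real^'m^'n \<Rightarrow> real^'m^'m \<Rightarrow> real^'p^'n \<Rightarrow> real \<Rightarrow> real^'n^'n \<Rightarrow> real^'n^'n" where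
  "closed_loop A B R E \<gamma> P =
     A - B ** matrix_inv R ** transpose B ** P
       + (1 / \<gamma>\<^sup>2) *\<^sub>R (E ** transpose E ** P)"


section \<open>Linear stochastic differential equations\<close>

text \<open>Only times \<open>t \<ge> 0\<close> matter; the filtration may be extended to \<open>t < 0\<close> by \<open>F 0\<close>.\<close>

locale brownian_motion =
  prob_space \<Omega> + filtration "space \<Omega>" F
  for \<Omega> :: "'w measure" and F :: "real \<Rightarrow> 'w measure" +
  fixes W :: "real \<Rightarrow> 'w \<Rightarrow> real"
  assumes filtration_events: "0 \<le> t \<Longrightarrow> sets (F t) \<subseteq> events"
    and adapted: "0 \<le> t \<Longrightarrow> W t \<in> borel_measurable (F t)"
    and starts_at_0: "AE \<omega> in \<Omega>. W 0 \<omega> = 0"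
    and increment_normal: "0 \<le> s \<Longrightarrow> s < t \<Longrightarrow>
      distributed \<Omega> lborel (\<lambda>\<omega>. W t \<omega> - W s \<omega>) (normal_density 0 (sqrt (t - s)))"
    and increment_indep: "0 \<le> s \<Longrightarrow> s < t \<Longrightarrow>
      indep_set (sets (F s)) (sets (vimage_algebra (space \<Omega>) (\<lambda>\<omega>. W t \<omega> - W s \<omega>) borel))"
    and continuous_paths: "AE \<omega> in \<Omega>. continuous_on {0..} (\<lambda>t. W t \<omega>)"
begin

text \<open>
  A simple integrand on \<open>{0..T}\<close> is given by nodes \<open>0 = \<tau> 0 \<le> \<dots> \<le> \<tau> N = T\<close> and
  square-integrable, \<open>F (\<tau> k)\<close>-measurable values \<open>\<xi> k\<close> on \<open>{\<tau> k<..\<tau> (Suc k)}\<close>.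
\<close>

definition simple_integrand ::
  "real \<Rightarrow> nat \<Rightarrow> (nat \<Rightarrow> real) \<Rightarrow> (nat \<Rightarrow> 'w \<Rightarrow> 'b::euclidean_space) \<Rightarrow> bool" where
  "simple_integrand T N \<tau> \<xi> \<longleftrightarrow>
     \<tau> 0 = 0 \<and> \<tau> N = T \<and>
     (\<forall>k<N. \<tau> k \<le> \<tau> (Suc k) \<and> \<xi> k \<in> borel_measurable (F (\<tau> k)) \<and>
            integrable \<Omega> (\<lambda>\<omega>. (norm (\<xi> k \<omega>))\<^sup>2))"

definition simple_process ::
  "nat \<Rightarrow> (nat \<Rightarrow> real) \<Rightarrow> (nat \<Rightarrow> 'w \<Rightarrow> 'b::euclidean_space) \<Rightarrow> real \<Rightarrow> 'w \<Rightarrow> 'b" where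
  "simple_process N \<tau> \<xi> s \<omega> = (\<Sum>k<N. indicator {\<tau> k<..\<tau> (Suc k)} s *\<^sub>R \<xi> k \<omega>)"

definition simple_integral ::
  "nat \<Rightarrow> (nat \<Rightarrow> real) \<Rightarrow> (nat \<Rightarrow> 'w \<Rightarrow> 'b::euclidean_space) \<Rightarrow> 'w \<Rightarrow> 'b" where
  "simple_integral N \<tau> \<xi> \<omega> = (\<Sum>k<N. (W (\<tau> (Suc k)) \<omega> - W (\<tau> k) \<omega>) *\<^sub>R \<xi> k \<omega>)"

abbreviation time_product :: "real \<Rightarrow> (real \<times> 'w) measure" where
  "time_product T \<equiv> restrict_space lborel {0..T} \<Otimes>\<^sub>M \<Omega>"

text \<open>
  \<open>I = \<integral>\<^sub>0\<^sup>T h dW\<close> in the sense of Ito: the \<open>L\<^sup>2\<close> limit of the integrals of simple integrands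
  that converge to \<open>h\<close> in \<open>L\<^sup>2({0..T} \<times> \<Omega>)\<close>. This determines \<open>I\<close> up to null sets.
\<close>

definition has_ito_integral ::
  "(real \<Rightarrow> 'w \<Rightarrow> 'b::euclidean_space) \<Rightarrow> real \<Rightarrow> ('w \<Rightarrow> 'b) \<Rightarrow> bool" where
  "has_ito_integral h T I \<longleftrightarrow>
     case_prod h \<in> borel_measurable (time_product T) \<and> I \<in> borel_measurable \<Omega> \<and>
     (\<exists>N \<tau> \<xi>.
        (\<forall>j. simple_integrand T (N j) (\<tau> j) (\<xi> j)) \<and>
        (\<lambda>j. \<integral>\<^sup>+(s, \<omega>). ennreal ((norm (h s \<omega> - simple_process (N j) (\<tau> j) (\<xi> j) s \<omega>))\<^sup>2)
               \<partial>time_product T) \<longlonglongrightarrow> 0 \<and>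
        (\<lambda>j. \<integral>\<^sup>+\<omega>. ennreal ((norm (I \<omega> - simple_integral (N j) (\<tau> j) (\<xi> j) \<omega>))\<^sup>2) \<partial>\<Omega>)
          \<longlonglongrightarrow> 0)"

text \<open>
  Strong solutions of \<open>dx = M x dt + A\<^sub>1 x dW\<close>, \<open>x(0) = x\<^sub>0\<close>. The second and third conditions are
  the usual class of continuous processes that are square-integrable on \<open>{0..T} \<times> \<Omega>\<close>, in which
  the solution is unique up to indistinguishability.
\<close>

definition solves_linear_sde ::
  "real^'n^'n \<Rightarrow> real^'n^'n \<Rightarrow> real^'n \<Rightarrow> (real \<Rightarrow> 'w \<Rightarrow> real^'n) \<Rightarrow> bool" where
  "solves_linear_sde M A\<^sub>1 x\<^sub>0 x \<longleftrightarrow>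
     (\<forall>t\<ge>0. x t \<in> borel_measurable (F t)) \<and>
     (AE \<omega> in \<Omega>. continuous_on {0..} (\<lambda>t. x t \<omega>)) \<and>
     (\<forall>T\<ge>0. case_prod x \<in> borel_measurable (time_product T) \<and>
        (\<integral>\<^sup>+(s, \<omega>). ennreal ((norm (x s \<omega>))\<^sup>2) \<partial>time_product T) < \<infinity>) \<and>
     (\<forall>t\<ge>0. \<exists>I. has_ito_integral (\<lambda>s \<omega>. A\<^sub>1 *v x s \<omega>) t I \<and>
        (AE \<omega> in \<Omega>. x t \<omega> = x\<^sub>0 + (LINT s:{0..t}|lborel. M *v x s \<omega>) + I \<omega>))"

text \<open>
  \<open>\<bbbE> \<parallel>x(t)\<parallel>\<^sup>2 \<longlongrightarrow> 0\<close> for every deterministic initial state. The expectation is an extended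
  nonnegative integral, so it cannot vanish for lack of integrability. Because solutions are unique
  up to indistinguishability, ``the solution'' is rendered by an existential quantifier.
\<close>

definition asymp_mean_square_stable :: "real^'n^'n \<Rightarrow> real^'n^'n \<Rightarrow> bool" where
  "asymp_mean_square_stable M A\<^sub>1 \<longleftrightarrow>
     (\<forall>x\<^sub>0. \<exists>x. solves_linear_sde M A\<^sub>1 x\<^sub>0 x \<and>
        ((\<lambda>t. \<integral>\<^sup>+\<omega>. ennreal ((norm (x t \<omega>))\<^sup>2) \<partial>\<Omega>) \<longlongrightarrow> 0) at_top)"

end

end

theory Submission
  imports Defs
begin

text \<open>
Write \<open>S = B R\<^sup>-\<^sup>1 B\<^sup>T - \<gamma>\<^sup>-\<^sup>2 E E\<^sup>T\<close>, so that the closed loop of \<open>P\<close> is \<open>A - S P\<close>. The policy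
update is Newton's method for the Riccati equation, whose left-hand side is quadratic in \<open>P\<close>:
subtracting the two equations leaves
\<open>L(P\<^sub>i\<^sub>+\<^sub>1 - P\<^sup>*) = - (P\<^sub>i - P\<^sup>*) S (P\<^sub>i - P\<^sup>*)\<close>, where \<open>L\<close> is the generalized Lyapunov operator
of the closed loop of \<open>P\<^sub>i\<close> (\<open>newton_error_equation\<close>). Both claims therefore follow from one
estimate: for \<open>M\<close> near the closed loop of \<open>P\<^sup>*\<close> the operators \<open>L\<^sub>M - \<mu>\<close> with \<open>Re \<mu> \<ge> 0\<close> are
bounded below by a common positive constant. The case \<open>\<mu> = 0\<close> gives the quadratic rate, and
all \<open>\<mu>\<close> together exclude spectrum in the closed right half plane. At the closed loop
of \<open>P\<^sup>*\<close> itself the bound follows from injectivity by compactness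
(\<open>resolvent_bound_exists\<close>), and it survives small perturbations with half the constant
(\<open>resolvent_bound_perturb\<close>).

Injectivity has to be extracted from mean square stability. If \<open>x\<close> and \<open>y\<close> solve
\<open>dx = M x dt + A\<^sub>1 x dW\<close> with initial states \<open>x\<^sub>0\<close> and \<open>y\<^sub>0\<close>, then
\<open>\<phi>\<^sub>X(t) = \<bbbE>(y(t)\<^sup>T X x(t))\<close> satisfies \<open>\<phi>\<^sub>X' = \<phi>\<^sub>L\<^sub>X\<close>. For an eigenvector \<open>L X = \<mu> X\<close> this
means \<open>\<phi>\<^sub>X(t) = exp(\<mu> t) y\<^sub>0\<^sup>T X x\<^sub>0\<close>. Stability makes the left-hand side tend to zero, while
\<open>Re \<mu> \<ge> 0\<close> keeps the right-hand side at least as large as \<open>y\<^sub>0\<^sup>T X x\<^sub>0\<close> in absolute value. Hence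
\<open>y\<^sub>0\<^sup>T X x\<^sub>0 = 0\<close> for all \<open>x\<^sub>0\<close>, \<open>y\<^sub>0\<close>, that is, \<open>X = 0\<close>
(\<open>stable_imp_no_unstable_eigenvector\<close>). Two different initial states are used because the
new iterate solves a linear matrix equation that carries no symmetry requirement, so \<open>L\<close> must be
injective on all matrices; a single solution would only see the symmetric part of \<open>X\<close>.

The differential equation for \<open>\<phi>\<^sub>X\<close> is the expectation of Ito's product rule
(\<open>expectation_product_ito_processes\<close>), derived here in \<open>L\<^sup>2\<close> from three facts: the Ito
isometry in polarized form, the martingale property
\<open>\<bbbE>(Z \<integral>\<^sub>0\<^sup>T h dW) = \<bbbE>(Z \<integral>\<^sub>0\<^sup>s h dW)\<close> for \<open>Z\<close> known at time \<open>s\<close>, and Fubini's theorem for the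
drift terms.
\<close>


section \<open>Square-integrable functions\<close>

text \<open>
Measurability is part of the notion because integrability of the square does not imply it.
\<close>

definition square_integrable :: "'a measure \<Rightarrow> ('a \<Rightarrow> real) \<Rightarrow> bool" where
  "square_integrable M f \<longleftrightarrow> f \<in> borel_measurable M \<and> integrable M (\<lambda>x. (f x)\<^sup>2)"

lemma square_integrable_measurable [measurable_dest]:
  "square_integrable M f \<Longrightarrow> f \<in> borel_measurable M"
  by (simp add: square_integrable_def)

lemma square_integrable_mult_integrable:
  assumes [measurable]: "square_integrable M f" "square_integrable M g"
  shows "integrable M (\<lambda>x. f x * g x)"
proof (rule Bochner_Integration.integrable_bound)
  show "integrable M (\<lambda>x. (f x)\<^sup>2 + (g x)\<^sup>2)"
    using assms by (simp add: square_integrable_def)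
  show "AE x in M. norm (f x * g x) \<le> norm ((f x)\<^sup>2 + (g x)\<^sup>2)"
  proof (rule AE_I2)
    fix x
    have "0 \<le> (\<bar>f x\<bar> - \<bar>g x\<bar>)\<^sup>2" by simp
    hence "2 * (\<bar>f x\<bar> * \<bar>g x\<bar>) \<le> (f x)\<^sup>2 + (g x)\<^sup>2"
      by (simp add: power2_diff)
    moreover have "0 \<le> \<bar>f x\<bar> * \<bar>g x\<bar>" by simp
    ultimately have "\<bar>f x\<bar> * \<bar>g x\<bar> \<le> (f x)\<^sup>2 + (g x)\<^sup>2" by linarith
    thus "norm (f x * g x) \<le> norm ((f x)\<^sup>2 + (g x)\<^sup>2)"
      by (simp add: abs_mult)
  qed
qed simp

lemma square_integrable_cmult:
  "square_integrable M f \<Longrightarrow> square_integrable M (\<lambda>x. c * f x)"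
  by (auto simp: square_integrable_def power_mult_distrib)

lemma square_integrable_minus:
  "square_integrable M f \<Longrightarrow> square_integrable M (\<lambda>x. - f x)"
  using square_integrable_cmult[of M f "-1"] by simp

lemma square_integrable_zero: "square_integrable M (\<lambda>x. 0)"
  by (simp add: square_integrable_def)

lemma square_integrable_add:
  assumes [measurable]: "square_integrable M f" "square_integrable M g"
  shows "square_integrable M (\<lambda>x. f x + g x)"
proof -
  have "integrable M (\<lambda>x. (f x)\<^sup>2 + (g x)\<^sup>2 + 2 * (f x * g x))"
    using assms square_integrable_mult_integrable[OF assms]
    by (simp add: square_integrable_def)
  thus ?thesis by (simp add: square_integrable_def power2_sum mult.assoc)
qed

lemma square_integrable_diff:
  assumes "square_integrable M f" "square_integrable M g"
  shows "square_integrable M (\<lambda>x. f x - g x)"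
  using square_integrable_add[OF assms(1) square_integrable_minus[OF assms(2)]] by simp

lemma square_integrable_sum:
  assumes "\<And>i. i \<in> I \<Longrightarrow> square_integrable M (f i)"
  shows "square_integrable M (\<lambda>x. \<Sum>i\<in>I. f i x)"
  using assms
  by (induction I rule: infinite_finite_induct)
     (auto simp: square_integrable_zero intro: square_integrable_add)

lemma square_integrable_bound:
  assumes "square_integrable M g" "f \<in> borel_measurable M" "AE x in M. \<bar>f x\<bar> \<le> \<bar>g x\<bar>"
  shows "square_integrable M f"
proof -
  have "integrable M (\<lambda>x. (f x)\<^sup>2)"
  proof (rule Bochner_Integration.integrable_bound)
    show "integrable M (\<lambda>x. (g x)\<^sup>2)" using assms by (simp add: square_integrable_def)
    show "AE x in M. norm ((f x)\<^sup>2) \<le> norm ((g x)\<^sup>2)"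
      using assms(3) by eventually_elim (simp add: abs_le_square_iff)
  qed (use assms in simp)
  thus ?thesis using assms by (simp add: square_integrable_def)
qed

lemma (in finite_measure) square_integrable_const: "square_integrable M (\<lambda>x. c)"
  by (simp add: square_integrable_def)

lemma (in finite_measure) square_integrable_integrable:
  "square_integrable M f \<Longrightarrow> integrable M f"
  using square_integrable_mult_integrable[OF _ square_integrable_const[of 1]] by simp

lemma square_integrable_iff_nn_integral:
  assumes [measurable]: "f \<in> borel_measurable M"
  shows "square_integrable M f \<longleftrightarrow> (\<integral>\<^sup>+x. ennreal ((f x)\<^sup>2) \<partial>M) < \<infinity>"
  by (simp add: square_integrable_def integrable_iff_bounded)

lemma nn_integral_square:
  "square_integrable M f \<Longrightarrow> (\<integral>\<^sup>+x. ennreal ((f x)\<^sup>2) \<partial>M) = ennreal (\<integral>x. (f x)\<^sup>2 \<partial>M)"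
  by (intro nn_integral_eq_integral) (auto simp: square_integrable_def)

text \<open>
The integral of \<open>(f - t g)\<^sup>2\<close> is a nonnegative quadratic polynomial in \<open>t\<close>. It is evaluated at its
minimum, or, when the quadratic coefficient vanishes, at a \<open>t\<close> where a nonzero linear
coefficient would make it negative.
\<close>

lemma Cauchy_Schwarz_integral:
  assumes f: "square_integrable M f" and g: "square_integrable M g"
  shows "(\<integral>x. f x * g x \<partial>M)\<^sup>2 \<le> (\<integral>x. (f x)\<^sup>2 \<partial>M) * (\<integral>x. (g x)\<^sup>2 \<partial>M)"
proof -
  define a b c where abc: "a = (\<integral>x. (f x)\<^sup>2 \<partial>M)" "b = (\<integral>x. (g x)\<^sup>2 \<partial>M)" "c = (\<integral>x. f x * g x \<partial>M)"
  (* The expansion of the integral of (f - t g)^2. *)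
  have q: "0 \<le> a - 2 * t * c + t\<^sup>2 * b" for t
  proof -
    have "0 \<le> (\<integral>x. (f x - t * g x)\<^sup>2 \<partial>M)" by simp
    also have "\<dots> = (\<integral>x. (f x)\<^sup>2 - (2 * t) * (f x * g x) + t\<^sup>2 * (g x)\<^sup>2 \<partial>M)"
      by (intro Bochner_Integration.integral_cong) (auto simp: power2_eq_square algebra_simps)
    also have "\<dots> = a - 2 * t * c + t\<^sup>2 * b"
      using f g square_integrable_mult_integrable[OF f g]
      by (simp add: abc square_integrable_def)
    finally show ?thesis .
  qed
  have b0: "b \<ge> 0" by (simp add: abc)
  show ?thesis
  proof (cases "b = 0")
    case True
    have "c = 0"
    proof (rule ccontr)
      assume "c \<noteq> 0"
      with q[of "(a + 1) / (2 * c)"] True show False by simp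
    qed
    with True show ?thesis by (simp add: abc)
  next
    case False
    hence "0 \<le> b * (a - 2 * (c / b) * c + (c / b)\<^sup>2 * b)"
      using q[of "c / b"] b0 by simp
    also have "\<dots> = a * b - c\<^sup>2" using False by (simp add: field_simps power2_eq_square)
    finally show ?thesis by (simp add: abc)
  qed
qed

text \<open>
Errors are measured by extended integrals in the definition of the Ito integral. As they tend to
zero, one of them is finite, which makes the limit square integrable; then all of them are
finite and may be replaced by ordinary integrals.
\<close>

lemma L2_limit:
  assumes f: "\<And>j. square_integrable M (f j)" and g[measurable]: "g \<in> borel_measurable M"
    and lim: "(\<lambda>j. \<integral>\<^sup>+x. ennreal ((g x - f j x)\<^sup>2) \<partial>M) \<longlonglongrightarrow> 0"
  shows "square_integrable M g" "(\<lambda>j. \<integral>x. (f j x - g x)\<^sup>2 \<partial>M) \<longlonglongrightarrow> 0"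
proof -
  note [measurable] = f[THEN square_integrable_measurable]
  have "\<forall>\<^sub>F j in sequentially. (\<integral>\<^sup>+x. ennreal ((g x - f j x)\<^sup>2) \<partial>M) < \<infinity>"
    using lim by (rule order_tendstoD) simp
  then obtain j where "(\<integral>\<^sup>+x. ennreal ((g x - f j x)\<^sup>2) \<partial>M) < \<infinity>"
    by (metis (mono_tags, lifting) eventually_sequentially order_refl)
  hence "square_integrable M (\<lambda>x. g x - f j x)"
    by (subst square_integrable_iff_nn_integral) auto
  from square_integrable_add[OF this f[of j]] show g2: "square_integrable M g" by simp
  have "ennreal (\<integral>x. (f j x - g x)\<^sup>2 \<partial>M) = (\<integral>\<^sup>+x. ennreal ((g x - f j x)\<^sup>2) \<partial>M)" for j
    using nn_integral_square[OF square_integrable_diff[OF g2 f[of j]]]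
    by (simp add: power2_commute)
  hence "(\<lambda>j. ennreal (\<integral>x. (f j x - g x)\<^sup>2 \<partial>M)) \<longlonglongrightarrow> ennreal 0"
    using lim by simp
  thus "(\<lambda>j. \<integral>x. (f j x - g x)\<^sup>2 \<partial>M) \<longlonglongrightarrow> 0"
    by (subst (asm) tendsto_ennreal_iff) auto
qed

text \<open>
Expanding \<open>f\<^sub>j g\<^sub>j\<close> around \<open>f\<^sub>0 g\<^sub>0\<close> leaves three error terms, each with a factor that tends to
zero in \<open>L\<^sup>2\<close>; the Cauchy-Schwarz inequality disposes of them.
\<close>

lemma L2_inner_tendsto:
  assumes f: "\<And>j. square_integrable M (f j)" "square_integrable M f0"
      "(\<lambda>j. \<integral>x. (f j x - f0 x)\<^sup>2 \<partial>M) \<longlonglongrightarrow> 0"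
    and g: "\<And>j. square_integrable M (g j)" "square_integrable M g0"
      "(\<lambda>j. \<integral>x. (g j x - g0 x)\<^sup>2 \<partial>M) \<longlonglongrightarrow> 0"
  shows "(\<lambda>j. \<integral>x. f j x * g j x \<partial>M) \<longlonglongrightarrow> (\<integral>x. f0 x * g0 x \<partial>M)"
proof -
  have aux: "(\<lambda>j. \<integral>x. p j x * q j x \<partial>M) \<longlonglongrightarrow> 0"
    if p: "\<And>j. square_integrable M (p j)" and q: "\<And>j. square_integrable M (q j)"
      and lim: "(\<lambda>j. (\<integral>x. (p j x)\<^sup>2 \<partial>M) * (\<integral>x. (q j x)\<^sup>2 \<partial>M)) \<longlonglongrightarrow> 0" for p q
  proof -
    have "(\<lambda>j. (\<integral>x. p j x * q j x \<partial>M)\<^sup>2) \<longlonglongrightarrow> 0"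
      by (rule tendsto_sandwich[OF _ _ tendsto_const lim])
         (auto intro!: always_eventually Cauchy_Schwarz_integral p q)
    from tendsto_real_sqrt[OF this] show ?thesis by (simp add: tendsto_rabs_zero_iff)
  qed
  note df = square_integrable_diff[OF f(1) f(2)]
  note dg = square_integrable_diff[OF g(1) g(2)]
  have "(\<lambda>j. (\<integral>x. (f j x - f0 x) * (g j x - g0 x) \<partial>M) + (\<integral>x. (f j x - f0 x) * g0 x \<partial>M)
       + (\<integral>x. f0 x * (g j x - g0 x) \<partial>M) + (\<integral>x. f0 x * g0 x \<partial>M))
     \<longlonglongrightarrow> 0 + 0 + 0 + (\<integral>x. f0 x * g0 x \<partial>M)"
  proof (intro tendsto_intros aux df dg f g)
    show "(\<lambda>j. (\<integral>x. (f j x - f0 x)\<^sup>2 \<partial>M) * (\<integral>x. (g j x - g0 x)\<^sup>2 \<partial>M)) \<longlonglongrightarrow> 0"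
      using tendsto_mult[OF f(3) g(3)] by simp
    show "(\<lambda>j. (\<integral>x. (f j x - f0 x)\<^sup>2 \<partial>M) * (\<integral>x. (g0 x)\<^sup>2 \<partial>M)) \<longlonglongrightarrow> 0"
      by (rule tendsto_mult_left_zero[OF f(3)])
    show "(\<lambda>j. (\<integral>x. (f0 x)\<^sup>2 \<partial>M) * (\<integral>x. (g j x - g0 x)\<^sup>2 \<partial>M)) \<longlonglongrightarrow> 0"
      by (rule tendsto_mult_right_zero[OF g(3)])
  qed
  moreover have "(\<integral>x. (f j x - f0 x) * (g j x - g0 x) \<partial>M) + (\<integral>x. (f j x - f0 x) * g0 x \<partial>M)
       + (\<integral>x. f0 x * (g j x - g0 x) \<partial>M) + (\<integral>x. f0 x * g0 x \<partial>M) = (\<integral>x. f j x * g j x \<partial>M)" for j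
  proof -
    note i = square_integrable_mult_integrable
    have "(\<integral>x. f j x * g j x \<partial>M) = (\<integral>x. (f j x - f0 x) * (g j x - g0 x) + (f j x - f0 x) * g0 x
       + f0 x * (g j x - g0 x) + f0 x * g0 x \<partial>M)"
      by (intro Bochner_Integration.integral_cong) (auto simp: algebra_simps)
    also have "\<dots> = (\<integral>x. (f j x - f0 x) * (g j x - g0 x) \<partial>M) + (\<integral>x. (f j x - f0 x) * g0 x \<partial>M)
       + (\<integral>x. f0 x * (g j x - g0 x) \<partial>M) + (\<integral>x. f0 x * g0 x \<partial>M)"
      using i[OF df[of j] dg[of j]] i[OF df[of j] g(2)] i[OF f(2) dg[of j]] i[OF f(2) g(2)] by simp
    finally show ?thesis by simp
  qed
  ultimately show ?thesis by simp
qed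


section \<open>Brownian increments and the isometry for simple integrands\<close>

lemma integral_pair_product:
  fixes f :: "'a \<Rightarrow> real" and g :: "'b \<Rightarrow> real"
  assumes "pair_sigma_finite M N" and f: "integrable M f" and g: "integrable N g"
  shows "integrable (M \<Otimes>\<^sub>M N) (\<lambda>(x, y). f x * g y)"
    and "(\<integral>z. (case z of (x, y) \<Rightarrow> f x * g y) \<partial>(M \<Otimes>\<^sub>M N)) = (\<integral>x. f x \<partial>M) * (\<integral>y. g y \<partial>N)"
proof -
  interpret pair_sigma_finite M N by fact
  have [measurable]: "f \<in> borel_measurable M" "g \<in> borel_measurable N" using f g by auto
  show *: "integrable (M \<Otimes>\<^sub>M N) (\<lambda>(x, y). f x * g y)"
    by (rule Fubini_integrable) (use f g in \<open>auto simp: abs_mult\<close>)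
  show "(\<integral>z. (case z of (x, y) \<Rightarrow> f x * g y) \<partial>(M \<Otimes>\<^sub>M N)) = (\<integral>x. f x \<partial>M) * (\<integral>y. g y \<partial>N)"
    using integral_fst[OF *] f g by simp
qed

lemma integral_sum_product:
  assumes f: "\<And>k. k < N \<Longrightarrow> square_integrable M (f k)"
    and g: "\<And>l. l < N' \<Longrightarrow> square_integrable M (g l)"
  shows "(\<integral>x. (\<Sum>k<N. f k x) * (\<Sum>l<N'. g l x) \<partial>M) = (\<Sum>k<(N::nat). \<Sum>l<(N'::nat). \<integral>x. f k x * g l x \<partial>M)"
proof -
  have i: "integrable M (\<lambda>x. f k x * g l x)" if "k < N" "l < N'" for k l
    using square_integrable_mult_integrable[OF f[OF that(1)] g[OF that(2)]] .
  have "(\<integral>x. (\<Sum>k<N. f k x) * (\<Sum>l<N'. g l x) \<partial>M) = (\<integral>x. (\<Sum>k<N. \<Sum>l<N'. f k x * g l x) \<partial>M)"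
    by (simp add: sum_product)
  also have "\<dots> = (\<Sum>k<N. \<integral>x. (\<Sum>l<N'. f k x * g l x) \<partial>M)"
    by (rule Bochner_Integration.integral_sum) (use i in auto)
  also have "\<dots> = (\<Sum>k<N. \<Sum>l<N'. \<integral>x. f k x * g l x \<partial>M)"
    by (intro sum.cong refl Bochner_Integration.integral_sum) (use i in auto)
  finally show ?thesis .
qed

abbreviation time_interval :: "real \<Rightarrow> real measure" where
  "time_interval T \<equiv> restrict_space lborel {0..T}"

lemma finite_time_interval: "finite_measure (time_interval T)"
proof (rule finite_measureI)
  have "emeasure lborel {0..T} \<noteq> \<infinity>" by (cases "0 \<le> T") auto
  thus "emeasure (time_interval T) (space (time_interval T)) \<noteq> \<infinity>"
    by (simp add: emeasure_restrict_space space_restrict_space)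
qed

text \<open>
The length of the intersection of \<open>{a<..b}\<close> and \<open>{c<..d}\<close>.
\<close>

definition overlap :: "real \<Rightarrow> real \<Rightarrow> real \<Rightarrow> real \<Rightarrow> real" where
  "overlap a b c d = max 0 (min b d - max a c)"

context brownian_motion
begin

abbreviation increment :: "real \<Rightarrow> real \<Rightarrow> 'w \<Rightarrow> real" where
  "increment a b \<omega> \<equiv> W b \<omega> - W a \<omega>"

lemma borel_measurable_F_mono:
  assumes "a \<le> b" "f \<in> borel_measurable (F a)" shows "f \<in> borel_measurable (F b)"
  by (rule borel_measurable_subalgebra[OF sets_F_mono[OF assms(1)] _ assms(2)]) (simp add: space_F)

lemma borel_measurable_F:
  assumes "0 \<le> a" "f \<in> borel_measurable (F a)" shows "f \<in> borel_measurable \<Omega>"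
  by (rule borel_measurable_subalgebra[OF filtration_events[OF assms(1)] _ assms(2)]) (simp add: space_F)

lemma W_measurable: "0 \<le> t \<Longrightarrow> W t \<in> borel_measurable \<Omega>"
  using borel_measurable_F adapted by blast

lemma increment_measurable_F: "0 \<le> a \<Longrightarrow> a \<le> b \<Longrightarrow> increment a b \<in> borel_measurable (F b)"
  using borel_measurable_F_mono[OF _ adapted, of a b] adapted[of b] by simp

text \<open>
The independence axiom of Brownian motion speaks of the whole \<open>\<sigma>\<close>-algebra of the past; it is used
through random variables that are measurable with respect to it.
\<close>

lemma past_increment_indep_var:
  assumes ab: "0 \<le> a" "a < b" and Z: "Z \<in> borel_measurable (F a)"
  shows "indep_var borel Z borel (increment a b)"
proof -
  have "sets (vimage_algebra (space \<Omega>) Z borel) \<subseteq> sets (F a)"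
    using Z by (simp add: measurable_iff_sets space_F)
  hence "indep_set (sets (vimage_algebra (space \<Omega>) Z borel))
           (sets (vimage_algebra (space \<Omega>) (increment a b) borel))"
    using increment_indep[OF ab] unfolding indep_sets2_eq by blast
  thus ?thesis
    using borel_measurable_F[OF ab(1) Z] W_measurable[of a] W_measurable[of b] ab
    by (simp add: indep_var_eq sets_vimage_algebra)
qed

lemma increment_moments:
  assumes ab: "0 \<le> a" "a < b"
  shows "integrable \<Omega> (increment a b)" "expectation (increment a b) = 0"
    "integrable \<Omega> (\<lambda>\<omega>. (increment a b \<omega>)\<^sup>2)" "expectation (\<lambda>\<omega>. (increment a b \<omega>)\<^sup>2) = b - a"
proof -
  define \<sigma> where "\<sigma> = sqrt (b - a)"
  have \<sigma>: "0 < \<sigma>" "\<sigma>\<^sup>2 = b - a" using ab by (auto simp: \<sigma>_def)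
  note D = increment_normal[OF ab, folded \<sigma>_def]
  show "integrable \<Omega> (increment a b)"
    using distributed_integrable_var[OF D] integrable_normal_moment_nz_1[OF \<sigma>(1)] by simp
  show E: "expectation (increment a b) = 0"
    by (rule normal_distributed_expectation[OF \<sigma>(1) D])
  show "integrable \<Omega> (\<lambda>\<omega>. (increment a b \<omega>)\<^sup>2)"
    using distributed_integrable[OF D, of "\<lambda>x. x\<^sup>2"] integrable_normal_moment[OF \<sigma>(1), of 0 2] by simp
  show "expectation (\<lambda>\<omega>. (increment a b \<omega>)\<^sup>2) = b - a"
    using normal_distributed_variance[OF \<sigma>(1) D] E \<sigma> by simp
qed

text \<open>
The factor \<open>Z\<close> is independent of the increment, which has mean \<open>0\<close> and variance \<open>b - a\<close>.
\<close>

lemma past_times_increment: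
  assumes ab: "0 \<le> a" "a \<le> b" and Z: "Z \<in> borel_measurable (F a)" "integrable \<Omega> Z"
  shows "integrable \<Omega> (\<lambda>\<omega>. Z \<omega> * increment a b \<omega>)"
    and "expectation (\<lambda>\<omega>. Z \<omega> * increment a b \<omega>) = 0"
    and "integrable \<Omega> (\<lambda>\<omega>. Z \<omega> * (increment a b \<omega>)\<^sup>2)"
    and "expectation (\<lambda>\<omega>. Z \<omega> * (increment a b \<omega>)\<^sup>2) = (b - a) * expectation Z"
proof -
  have "integrable \<Omega> (\<lambda>\<omega>. Z \<omega> * increment a b \<omega>) \<and>
     expectation (\<lambda>\<omega>. Z \<omega> * increment a b \<omega>) = 0 \<and>
     integrable \<Omega> (\<lambda>\<omega>. Z \<omega> * (increment a b \<omega>)\<^sup>2) \<and>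
     expectation (\<lambda>\<omega>. Z \<omega> * (increment a b \<omega>)\<^sup>2) = (b - a) * expectation Z"
  proof (cases "a = b")
    case False
    hence ab': "0 \<le> a" "a < b" using ab by auto
    note ind = past_increment_indep_var[OF ab' Z(1)]
    have ind2: "indep_var borel Z borel (\<lambda>\<omega>. (increment a b \<omega>)\<^sup>2)"
      using indep_var_compose[OF ind, of "\<lambda>x. x" borel "\<lambda>x. x\<^sup>2" borel] by (simp add: comp_def)
    note mom = increment_moments[OF ab']
    show ?thesis
      using indep_var_integrable[OF ind Z(2) mom(1)] indep_var_lebesgue_integral[OF ind Z(2) mom(1)]
        indep_var_integrable[OF ind2 Z(2) mom(3)] indep_var_lebesgue_integral[OF ind2 Z(2) mom(3)] mom
      by simp
  qed simp
  thus "integrable \<Omega> (\<lambda>\<omega>. Z \<omega> * increment a b \<omega>)"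
    and "expectation (\<lambda>\<omega>. Z \<omega> * increment a b \<omega>) = 0"
    and "integrable \<Omega> (\<lambda>\<omega>. Z \<omega> * (increment a b \<omega>)\<^sup>2)"
    and "expectation (\<lambda>\<omega>. Z \<omega> * (increment a b \<omega>)\<^sup>2) = (b - a) * expectation Z"
    by auto
qed

text \<open>
Splitting the longer increment at \<open>b\<close> leaves the square of the shorter one and a part after
time \<open>b\<close>, which is uncorrelated with everything that is known at time \<open>b\<close>.
\<close>

lemma past_times_two_increments_aux:
  assumes "0 \<le> c" "c \<le> b" "b \<le> d" and Z: "Z \<in> borel_measurable (F c)" "integrable \<Omega> Z"
  shows "integrable \<Omega> (\<lambda>\<omega>. Z \<omega> * (increment c b \<omega> * increment c d \<omega>)) \<and>
    expectation (\<lambda>\<omega>. Z \<omega> * (increment c b \<omega> * increment c d \<omega>)) = (b - c) * expectation Z"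
proof -
  note 1 = past_times_increment[OF assms(1,2) Z]
  have Z2: "(\<lambda>\<omega>. Z \<omega> * increment c b \<omega>) \<in> borel_measurable (F b)"
    using borel_measurable_F_mono[OF assms(2) Z(1)] increment_measurable_F[OF assms(1,2)] by simp
  note 2 = past_times_increment[OF order_trans[OF assms(1,2)] assms(3) Z2 1(1)]
  have "(\<lambda>\<omega>. Z \<omega> * (increment c b \<omega> * increment c d \<omega>)) =
     (\<lambda>\<omega>. Z \<omega> * (increment c b \<omega>)\<^sup>2 + Z \<omega> * increment c b \<omega> * increment b d \<omega>)"
    by (auto simp: power2_eq_square algebra_simps)
  thus ?thesis using 1 2 by simp
qed

lemma past_times_two_increments:
  assumes "0 \<le> c" "c \<le> b" "c \<le> d" and Z: "Z \<in> borel_measurable (F c)" "integrable \<Omega> Z"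
  shows "integrable \<Omega> (\<lambda>\<omega>. Z \<omega> * (increment c b \<omega> * increment c d \<omega>)) \<and>
    expectation (\<lambda>\<omega>. Z \<omega> * (increment c b \<omega> * increment c d \<omega>)) = (min b d - c) * expectation Z"
proof (cases "b \<le> d")
  case True
  thus ?thesis using past_times_two_increments_aux[of c b d Z] assms by (simp add: min_def)
next
  case False
  thus ?thesis using past_times_two_increments_aux[of c d b Z] assms
    by (simp add: min_def mult.commute)
qed

lemma square_integrable_times_increment:
  assumes "0 \<le> a" "a \<le> b" and \<xi>: "\<xi> \<in> borel_measurable (F a)" "integrable \<Omega> (\<lambda>\<omega>. (\<xi> \<omega>)\<^sup>2)"
  shows "square_integrable \<Omega> (\<lambda>\<omega>. increment a b \<omega> * \<xi> \<omega>)"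
  using past_times_increment(3)[OF assms(1,2), of "\<lambda>\<omega>. (\<xi> \<omega>)\<^sup>2"] \<xi> borel_measurable_F[OF _ \<xi>(1)] assms
    W_measurable[of a] W_measurable[of b]
  by (auto simp: square_integrable_def power_mult_distrib mult.commute)

text \<open>
Splitting the first increment at \<open>c\<close>: the part before \<open>c\<close> belongs to the past of the second
increment and contributes nothing, and the part after \<open>c\<close> starts together with the second one.
\<close>

lemma increments_inner_aux:
  assumes "0 \<le> a" "a \<le> b" "a \<le> c" "c \<le> d"
    and \<xi>: "\<xi> \<in> borel_measurable (F a)" "integrable \<Omega> (\<lambda>\<omega>. (\<xi> \<omega>)\<^sup>2)"
    and \<eta>: "\<eta> \<in> borel_measurable (F c)" "integrable \<Omega> (\<lambda>\<omega>. (\<eta> \<omega>)\<^sup>2)"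
  shows "expectation (\<lambda>\<omega>. (increment a b \<omega> * \<xi> \<omega>) * (increment c d \<omega> * \<eta> \<omega>)) =
    overlap a b c d * expectation (\<lambda>\<omega>. \<xi> \<omega> * \<eta> \<omega>)"
proof -
  have c0: "0 \<le> c" using assms by simp
  have \<eta>2: "square_integrable \<Omega> \<eta>"
    using borel_measurable_F[OF c0 \<eta>(1)] \<eta>(2) by (simp add: square_integrable_def)
  have \<xi>2: "square_integrable \<Omega> \<xi>"
    using borel_measurable_F[OF assms(1) \<xi>(1)] \<xi>(2) by (simp add: square_integrable_def)
  note \<xi>c = borel_measurable_F_mono[OF assms(3) \<xi>(1)]
  (* If b \<le> c, the whole first increment lies before c. *)
  define m where "m = min b c"
  have m: "a \<le> m" "m \<le> c" using assms by (auto simp: m_def)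
  define Z where "Z = (\<lambda>\<omega>. (increment a m \<omega> * \<xi> \<omega>) * \<eta> \<omega>)"
  have Z: "Z \<in> borel_measurable (F c)" "integrable \<Omega> Z"
    using borel_measurable_F_mono[OF m(2) increment_measurable_F[OF assms(1) m(1)]] \<xi>c \<eta>(1)
      square_integrable_mult_integrable[OF square_integrable_times_increment[OF assms(1) m(1) \<xi>] \<eta>2]
    by (auto simp: Z_def)
  note 1 = past_times_increment[OF c0 assms(4) Z]
  show ?thesis
  proof (cases "b \<le> c")
    case True
    hence "expectation (\<lambda>\<omega>. (increment a b \<omega> * \<xi> \<omega>) * (increment c d \<omega> * \<eta> \<omega>)) =
      expectation (\<lambda>\<omega>. Z \<omega> * increment c d \<omega>)"
      by (intro Bochner_Integration.integral_cong) (auto simp: Z_def m_def)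
    thus ?thesis using 1 True assms by (simp add: overlap_def)
  next
    case False
    hence cb: "c \<le> b" by simp
    have Y: "(\<lambda>\<omega>. \<xi> \<omega> * \<eta> \<omega>) \<in> borel_measurable (F c)" using \<xi>c \<eta>(1) by simp
    note 2 = past_times_two_increments[OF c0 cb assms(4) Y square_integrable_mult_integrable[OF \<xi>2 \<eta>2]]
    have "expectation (\<lambda>\<omega>. (increment a b \<omega> * \<xi> \<omega>) * (increment c d \<omega> * \<eta> \<omega>)) =
      expectation (\<lambda>\<omega>. Z \<omega> * increment c d \<omega> + \<xi> \<omega> * \<eta> \<omega> * (increment c b \<omega> * increment c d \<omega>))"
      using False by (intro Bochner_Integration.integral_cong) (auto simp: Z_def m_def algebra_simps)
    also have "\<dots> = (min b d - c) * expectation (\<lambda>\<omega>. \<xi> \<omega> * \<eta> \<omega>)" using 1 2 by simp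
    also have "min b d - c = overlap a b c d" using False assms by (auto simp: overlap_def)
    finally show ?thesis .
  qed
qed

lemma increments_inner:
  assumes "0 \<le> a" "a \<le> b" "0 \<le> c" "c \<le> d"
    and \<xi>: "\<xi> \<in> borel_measurable (F a)" "integrable \<Omega> (\<lambda>\<omega>. (\<xi> \<omega>)\<^sup>2)"
    and \<eta>: "\<eta> \<in> borel_measurable (F c)" "integrable \<Omega> (\<lambda>\<omega>. (\<eta> \<omega>)\<^sup>2)"
  shows "expectation (\<lambda>\<omega>. (increment a b \<omega> * \<xi> \<omega>) * (increment c d \<omega> * \<eta> \<omega>)) =
    overlap a b c d * expectation (\<lambda>\<omega>. \<xi> \<omega> * \<eta> \<omega>)"
proof (cases "a \<le> c")
  case True
  thus ?thesis using increments_inner_aux assms by blast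
next
  case False
  hence "expectation (\<lambda>\<omega>. (increment c d \<omega> * \<eta> \<omega>) * (increment a b \<omega> * \<xi> \<omega>)) =
    overlap c d a b * expectation (\<lambda>\<omega>. \<eta> \<omega> * \<xi> \<omega>)"
    using assms by (intro increments_inner_aux) auto
  moreover have "overlap c d a b = overlap a b c d" by (simp add: overlap_def min.commute max.commute)
  ultimately show ?thesis by (simp add: mult.commute)
qed

lemma simple_integrand_nodes:
  assumes "simple_integrand T N \<tau> \<xi>"
  shows "k \<le> N \<Longrightarrow> 0 \<le> \<tau> k" "k \<le> N \<Longrightarrow> \<tau> k \<le> T" "0 \<le> T"
proof -
  have step: "\<tau> k \<le> \<tau> (Suc k)" if "k < N" for k using assms that by (simp add: simple_integrand_def)
  have mono: "i \<le> j \<Longrightarrow> j \<le> N \<Longrightarrow> \<tau> i \<le> \<tau> j" for i j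
    by (induction j rule: dec_induct) (auto intro: order_trans[OF _ step])
  have "\<tau> 0 = 0" "\<tau> N = T" using assms by (auto simp: simple_integrand_def)
  thus "k \<le> N \<Longrightarrow> 0 \<le> \<tau> k" "k \<le> N \<Longrightarrow> \<tau> k \<le> T" "0 \<le> T"
    using mono[of 0 k] mono[of k N] mono[of 0 N] by auto
qed

lemma simple_integrandD:
  assumes "simple_integrand T N \<tau> \<xi>" "k < N"
  shows "0 \<le> \<tau> k" "\<tau> k \<le> \<tau> (Suc k)" "\<tau> (Suc k) \<le> T" "\<xi> k \<in> borel_measurable (F (\<tau> k))"
    "integrable \<Omega> (\<lambda>\<omega>. (norm (\<xi> k \<omega>))\<^sup>2)"
  using assms simple_integrand_nodes(1,2)[OF assms(1), of k] simple_integrand_nodes(1,2)[OF assms(1), of "Suc k"]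
  by (auto simp: simple_integrand_def)

lemma square_integrable_simple_integral:
  fixes \<xi> :: "nat \<Rightarrow> 'w \<Rightarrow> real"
  assumes s: "simple_integrand T N \<tau> \<xi>"
  shows "square_integrable \<Omega> (simple_integral N \<tau> \<xi>)"
  unfolding simple_integral_def real_scaleR_def
  by (intro square_integrable_sum square_integrable_times_increment)
     (use simple_integrandD[OF s] in auto)

lemma pair_sigma_finite_time_product: "pair_sigma_finite (time_interval T) \<Omega>"
  by (intro pair_sigma_finite.intro finite_measure.axioms finite_time_interval sigma_finite_measure_axioms)

lemma simple_term_square_integrable:
  fixes \<xi> :: "'w \<Rightarrow> real"
  assumes "0 \<le> a" and \<xi>: "\<xi> \<in> borel_measurable (F a)" "integrable \<Omega> (\<lambda>\<omega>. (norm (\<xi> \<omega>))\<^sup>2)"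
  shows "square_integrable (time_product T) (\<lambda>z. indicator {a<..b} (fst z) * \<xi> (snd z))"
proof -
  have [measurable]: "\<xi> \<in> borel_measurable \<Omega>" using borel_measurable_F[OF assms(1) \<xi>(1)] .
  have [measurable]: "(indicator {a<..b} :: real \<Rightarrow> real) \<in> borel_measurable (time_interval T)"
    by (intro measurable_restrict_space1) simp
  interpret R: finite_measure "time_interval T" by (rule finite_time_interval)
  have "integrable (time_interval T) (\<lambda>s. (indicator {a<..b} s)\<^sup>2 :: real)"
  proof (rule R.integrable_const_bound[where B = 1])
    show "AE s in time_interval T. norm ((indicator {a<..b} s)\<^sup>2 :: real) \<le> 1"
      by (auto simp: indicator_def)
  qed measurable
  from integral_pair_product(1)[OF pair_sigma_finite_time_product this, of "\<lambda>\<omega>. (\<xi> \<omega>)\<^sup>2"]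
  show ?thesis using \<xi> by (auto simp: square_integrable_def power_mult_distrib split_beta')
qed

text \<open>
The counterpart of \<open>increments_inner\<close> on the side of the integrands; the two agree because the
variance of a Brownian increment is its length.
\<close>

lemma simple_terms_inner:
  fixes \<xi> \<eta> :: "'w \<Rightarrow> real"
  assumes "0 \<le> a" "a \<le> b" "b \<le> T" "0 \<le> c" "c \<le> d" "d \<le> T"
    and \<xi>: "\<xi> \<in> borel_measurable (F a)" "integrable \<Omega> (\<lambda>\<omega>. (norm (\<xi> \<omega>))\<^sup>2)"
    and \<eta>: "\<eta> \<in> borel_measurable (F c)" "integrable \<Omega> (\<lambda>\<omega>. (norm (\<eta> \<omega>))\<^sup>2)"
  shows "(\<integral>z. (indicator {a<..b} (fst z) * \<xi> (snd z)) * (indicator {c<..d} (fst z) * \<eta> (snd z)) \<partial>time_product T)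
    = overlap a b c d * expectation (\<lambda>\<omega>. \<xi> \<omega> * \<eta> \<omega>)"
proof -
  interpret R: finite_measure "time_interval T" by (rule finite_time_interval)
  have \<xi>\<eta>: "square_integrable \<Omega> \<xi>" "square_integrable \<Omega> \<eta>"
    using borel_measurable_F[OF assms(1) \<xi>(1)] \<xi>(2) borel_measurable_F[OF assms(4) \<eta>(1)] \<eta>(2)
    by (auto simp: square_integrable_def)
  define J where "J = {max a c<..min b d}"
  have J: "J \<subseteq> {0..T}" "J \<in> sets (time_interval T)" "J \<in> sets lborel"
    using assms by (auto simp: J_def sets_restrict_space_iff)
  have "measure (time_interval T) J = measure lborel J"
    using J by (simp add: measure_restrict_space)
  also have "\<dots> = overlap a b c d" by (auto simp: J_def overlap_def max_def)
  finally have mJ: "measure (time_interval T) J = overlap a b c d" .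
  have int: "integrable (time_interval T) (indicator J :: real \<Rightarrow> real)"
    using J R.emeasure_finite[of J] by (intro integrable_real_indicator) (auto simp: less_top[symmetric])
  have "(\<integral>z. (indicator {a<..b} (fst z) * \<xi> (snd z)) * (indicator {c<..d} (fst z) * \<eta> (snd z)) \<partial>time_product T)
     = (\<integral>z. (case z of (s, \<omega>) \<Rightarrow> indicator J s * (\<xi> \<omega> * \<eta> \<omega>)) \<partial>time_product T)"
    by (intro Bochner_Integration.integral_cong) (auto simp: J_def indicator_def)
  also have "\<dots> = (\<integral>s. indicator J s \<partial>time_interval T) * expectation (\<lambda>\<omega>. \<xi> \<omega> * \<eta> \<omega>)"
    by (rule integral_pair_product(2)[OF pair_sigma_finite_time_product int
          square_integrable_mult_integrable[OF \<xi>\<eta>]])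
  also have "(\<integral>s. indicator J s \<partial>time_interval T) = overlap a b c d"
    using J mJ by (simp add: space_restrict_space Int_absorb2)
  finally show ?thesis .
qed

lemma simple_process_alt:
  fixes \<xi> :: "nat \<Rightarrow> 'w \<Rightarrow> real"
  shows "case_prod (simple_process N \<tau> \<xi>) =
    (\<lambda>z. \<Sum>k<N. indicator {\<tau> k<..\<tau> (Suc k)} (fst z) * \<xi> k (snd z))"
  by (auto simp: simple_process_def)

lemma square_integrable_simple_process:
  fixes \<xi> :: "nat \<Rightarrow> 'w \<Rightarrow> real"
  assumes s: "simple_integrand T N \<tau> \<xi>"
  shows "square_integrable (time_product T') (case_prod (simple_process N \<tau> \<xi>))"
  unfolding simple_process_alt
  by (intro square_integrable_sum simple_term_square_integrable) (use simple_integrandD[OF s] in auto)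

text \<open>
Expanding both sides over pairs of partition intervals gives the same double sum of overlaps,
whatever the two partitions are. This polarized form yields inner products of integrals
directly.
\<close>

lemma simple_integral_isometry:
  fixes \<xi> \<eta> :: "nat \<Rightarrow> 'w \<Rightarrow> real"
  assumes s: "simple_integrand T N \<tau> \<xi>" and s': "simple_integrand T N' \<tau>' \<eta>"
  shows "expectation (\<lambda>\<omega>. simple_integral N \<tau> \<xi> \<omega> * simple_integral N' \<tau>' \<eta> \<omega>) =
    (\<integral>z. case_prod (simple_process N \<tau> \<xi>) z * case_prod (simple_process N' \<tau>' \<eta>) z \<partial>time_product T)"
proof -
  note D = simple_integrandD[OF s] and D' = simple_integrandD[OF s']
  have q: "square_integrable \<Omega> (\<lambda>\<omega>. increment (\<tau> k) (\<tau> (Suc k)) \<omega> * \<xi> k \<omega>)" if "k < N" for k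
    using D[OF that] by (intro square_integrable_times_increment) auto
  have q': "square_integrable \<Omega> (\<lambda>\<omega>. increment (\<tau>' l) (\<tau>' (Suc l)) \<omega> * \<eta> l \<omega>)" if "l < N'" for l
    using D'[OF that] by (intro square_integrable_times_increment) auto
  have "expectation (\<lambda>\<omega>. simple_integral N \<tau> \<xi> \<omega> * simple_integral N' \<tau>' \<eta> \<omega>) =
    (\<Sum>k<N. \<Sum>l<N'. expectation (\<lambda>\<omega>. (increment (\<tau> k) (\<tau> (Suc k)) \<omega> * \<xi> k \<omega>) *
        (increment (\<tau>' l) (\<tau>' (Suc l)) \<omega> * \<eta> l \<omega>)))"
    unfolding simple_integral_def real_scaleR_def by (rule integral_sum_product[OF q q'])
  also have "\<dots> = (\<Sum>k<N. \<Sum>l<N'. overlap (\<tau> k) (\<tau> (Suc k)) (\<tau>' l) (\<tau>' (Suc l)) *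
       expectation (\<lambda>\<omega>. \<xi> k \<omega> * \<eta> l \<omega>))"
    by (intro sum.cong refl increments_inner) (use D D' in auto)
  also have "\<dots> = (\<Sum>k<N. \<Sum>l<N'. (\<integral>z. (indicator {\<tau> k<..\<tau> (Suc k)} (fst z) * \<xi> k (snd z)) *
      (indicator {\<tau>' l<..\<tau>' (Suc l)} (fst z) * \<eta> l (snd z)) \<partial>time_product T))"
    by (intro sum.cong refl simple_terms_inner[symmetric]) (use D D' in auto)
  also have "\<dots> = (\<integral>z. case_prod (simple_process N \<tau> \<xi>) z * case_prod (simple_process N' \<tau>' \<eta>) z \<partial>time_product T)"
    unfolding simple_process_alt
    by (rule integral_sum_product[OF simple_term_square_integrable[OF D(1,4,5)]
          simple_term_square_integrable[OF D'(1,4,5)], symmetric])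
  finally show ?thesis .
qed

end


section \<open>The Ito isometry and the martingale property\<close>

context brownian_motion
begin

lemma time_product_mono_measurable:
  assumes "s \<le> T" and f: "f \<in> borel_measurable (time_product T)"
  shows "f \<in> borel_measurable (time_product s)"
proof -
  have "(\<lambda>x. x) \<in> measurable (time_interval s) (time_interval T)"
    by (rule measurable_restrict_space3) (use assms in auto)
  hence "(\<lambda>z. (fst z, snd z)) \<in> measurable (time_product s) (time_product T)"
    by measurable
  hence "(\<lambda>z. z) \<in> measurable (time_product s) (time_product T)" by simp
  from measurable_compose[OF this f] show ?thesis by simp
qed

lemma nn_integral_time_product:
  assumes f: "f \<in> borel_measurable (time_product T)"
  shows "(\<integral>\<^sup>+z. f z \<partial>time_product T) = (\<integral>\<^sup>+s. (\<integral>\<^sup>+\<omega>. f (s, \<omega>) \<partial>\<Omega>) * indicator {0..T} s \<partial>lborel)"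
  using nn_integral_fst[OF f] by (simp add: nn_integral_restrict_space)

text \<open>
Used to restrict an approximation in \<open>L\<^sup>2({0..T} \<times> \<Omega>)\<close> to a shorter time interval.
\<close>

lemma nn_integral_time_product_mono:
  assumes "s \<le> T" and f: "f \<in> borel_measurable (time_product T)"
  shows "(\<integral>\<^sup>+z. f z \<partial>time_product s) \<le> (\<integral>\<^sup>+z. f z \<partial>time_product T)"
  unfolding nn_integral_time_product[OF f]
    nn_integral_time_product[OF time_product_mono_measurable[OF assms]]
  by (intro nn_integral_mono mult_left_mono) (use assms in \<open>auto simp: indicator_def\<close>)

text \<open>
A contraction to the real line maps approximating simple integrands to approximating simple
integrands. With unit vectors this reduces vector-valued Ito integrals to their components.
\<close>

lemma has_ito_integral_inner:
  fixes h :: "real \<Rightarrow> 'w \<Rightarrow> 'b::euclidean_space"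
  assumes h: "has_ito_integral h T I" and b: "norm b \<le> 1"
  shows "has_ito_integral (\<lambda>s \<omega>. h s \<omega> \<bullet> b) T (\<lambda>\<omega>. I \<omega> \<bullet> b)"
proof -
  from h obtain N \<tau> \<xi> where
    hm: "case_prod h \<in> borel_measurable (time_product T)" and Im[measurable]: "I \<in> borel_measurable \<Omega>"
    and s: "\<And>j. simple_integrand T (N j) (\<tau> j) (\<xi> j)"
    and l1: "(\<lambda>j. \<integral>\<^sup>+(s, \<omega>). ennreal ((norm (h s \<omega> - simple_process (N j) (\<tau> j) (\<xi> j) s \<omega>))\<^sup>2)
               \<partial>time_product T) \<longlonglongrightarrow> 0"
    and l2: "(\<lambda>j. \<integral>\<^sup>+\<omega>. ennreal ((norm (I \<omega> - simple_integral (N j) (\<tau> j) (\<xi> j) \<omega>))\<^sup>2) \<partial>\<Omega>)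
          \<longlonglongrightarrow> 0"
    unfolding has_ito_integral_def by blast
  define \<eta> where "\<eta> = (\<lambda>j k \<omega>. \<xi> j k \<omega> \<bullet> b)"
  have contract: "(x \<bullet> b)\<^sup>2 \<le> (norm x)\<^sup>2" for x
  proof -
    have "\<bar>x \<bullet> b\<bar> \<le> norm x * norm b" by (rule Cauchy_Schwarz_ineq2)
    also have "\<dots> \<le> norm x" using b by (simp add: mult_left_le)
    finally show ?thesis by (metis abs_norm_cancel abs_le_square_iff)
  qed
  have "simple_integrand T (N j) (\<tau> j) (\<eta> j)" for j
    unfolding simple_integrand_def
  proof (intro conjI allI impI)
    show "\<tau> j 0 = 0" "\<tau> j (N j) = T" using s[of j] by (auto simp: simple_integrand_def)
    fix k assume k: "k < N j"
    note D = simple_integrandD[OF s k]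
    show "\<tau> j k \<le> \<tau> j (Suc k)" using D by simp
    show "\<eta> j k \<in> borel_measurable (F (\<tau> j k))" using D(4) unfolding \<eta>_def by simp
    have [measurable]: "\<xi> j k \<in> borel_measurable \<Omega>" using borel_measurable_F D by blast
    show "integrable \<Omega> (\<lambda>\<omega>. (norm (\<eta> j k \<omega>))\<^sup>2)"
      by (rule Bochner_Integration.integrable_bound[OF D(5)]) (auto simp: \<eta>_def contract)
  qed
  moreover have "h s \<omega> \<bullet> b - simple_process (N j) (\<tau> j) (\<eta> j) s \<omega> =
      (h s \<omega> - simple_process (N j) (\<tau> j) (\<xi> j) s \<omega>) \<bullet> b" for j s \<omega>
    by (simp add: simple_process_def \<eta>_def inner_sum_left inner_diff_left)
  hence "(\<lambda>j. \<integral>\<^sup>+(s, \<omega>). ennreal ((norm (h s \<omega> \<bullet> b - simple_process (N j) (\<tau> j) (\<eta> j) s \<omega>))\<^sup>2)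
               \<partial>time_product T) \<longlonglongrightarrow> 0"
    by (intro tendsto_sandwich[OF _ _ tendsto_const l1] always_eventually)
       (auto intro!: nn_integral_mono contract)
  moreover have "I \<omega> \<bullet> b - simple_integral (N j) (\<tau> j) (\<eta> j) \<omega> =
      (I \<omega> - simple_integral (N j) (\<tau> j) (\<xi> j) \<omega>) \<bullet> b" for j \<omega>
    by (simp add: simple_integral_def \<eta>_def inner_sum_left inner_diff_left)
  hence "(\<lambda>j. \<integral>\<^sup>+\<omega>. ennreal ((norm (I \<omega> \<bullet> b - simple_integral (N j) (\<tau> j) (\<eta> j) \<omega>))\<^sup>2) \<partial>\<Omega>) \<longlonglongrightarrow> 0"
    by (intro tendsto_sandwich[OF _ _ tendsto_const l2] always_eventually)
       (auto intro!: nn_integral_mono contract)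
  moreover have "case_prod (\<lambda>s \<omega>. h s \<omega> \<bullet> b) \<in> borel_measurable (time_product T)"
    using borel_measurable_inner[OF hm borel_measurable_const[of b]] by (simp add: split_beta')
  moreover have "(\<lambda>\<omega>. I \<omega> \<bullet> b) \<in> borel_measurable \<Omega>" by measurable
  ultimately show ?thesis unfolding has_ito_integral_def by blast
qed

text \<open>
A witness of the existential quantifier in the definition of a real Ito integral, with the double
integral taken over a pair.
\<close>

definition ito_approximation :: "(real \<Rightarrow> 'w \<Rightarrow> real) \<Rightarrow> real \<Rightarrow> ('w \<Rightarrow> real) \<Rightarrow>
    (nat \<Rightarrow> nat) \<Rightarrow> (nat \<Rightarrow> nat \<Rightarrow> real) \<Rightarrow> (nat \<Rightarrow> nat \<Rightarrow> 'w \<Rightarrow> real) \<Rightarrow> bool" where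
  "ito_approximation h T I N \<tau> \<xi> \<longleftrightarrow>
     case_prod h \<in> borel_measurable (time_product T) \<and> I \<in> borel_measurable \<Omega> \<and>
     (\<forall>j. simple_integrand T (N j) (\<tau> j) (\<xi> j)) \<and>
     (\<lambda>j. \<integral>\<^sup>+z. ennreal ((case_prod h z - case_prod (simple_process (N j) (\<tau> j) (\<xi> j)) z)\<^sup>2)
       \<partial>time_product T) \<longlonglongrightarrow> 0 \<and>
     (\<lambda>j. \<integral>\<^sup>+\<omega>. ennreal ((I \<omega> - simple_integral (N j) (\<tau> j) (\<xi> j) \<omega>)\<^sup>2) \<partial>\<Omega>) \<longlonglongrightarrow> 0"

lemma ito_approximation_exists:
  assumes "has_ito_integral h T I"
  shows "\<exists>N \<tau> \<xi>. ito_approximation h T I N \<tau> \<xi>"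
  using assms by (simp add: has_ito_integral_def ito_approximation_def split_beta')

lemma ito_approximationD:
  assumes "ito_approximation h T I N \<tau> \<xi>"
  shows "\<And>j. simple_integrand T (N j) (\<tau> j) (\<xi> j)"
    and "square_integrable (time_product T) (case_prod h)" and "square_integrable \<Omega> I"
    and "(\<lambda>j. \<integral>z. (case_prod (simple_process (N j) (\<tau> j) (\<xi> j)) z - case_prod h z)\<^sup>2
           \<partial>time_product T) \<longlonglongrightarrow> 0"
    and "(\<lambda>j. \<integral>\<omega>. (simple_integral (N j) (\<tau> j) (\<xi> j) \<omega> - I \<omega>)\<^sup>2 \<partial>\<Omega>) \<longlonglongrightarrow> 0"
proof -
  note A = assms[unfolded ito_approximation_def]
  show s: "simple_integrand T (N j) (\<tau> j) (\<xi> j)" for j using A by blast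
  note L1 = L2_limit[OF square_integrable_simple_process[OF s] A[THEN conjunct1]
      A[THEN conjunct2, THEN conjunct2, THEN conjunct2, THEN conjunct1]]
  note L2 = L2_limit[OF square_integrable_simple_integral[OF s] A[THEN conjunct2, THEN conjunct1]
      A[THEN conjunct2, THEN conjunct2, THEN conjunct2, THEN conjunct2]]
  show "square_integrable (time_product T) (case_prod h)" "square_integrable \<Omega> I"
    by (fact L1(1), fact L2(1))
  show "(\<lambda>j. \<integral>z. (case_prod (simple_process (N j) (\<tau> j) (\<xi> j)) z - case_prod h z)\<^sup>2
           \<partial>time_product T) \<longlonglongrightarrow> 0"
    by (fact L1(2))
  show "(\<lambda>j. \<integral>\<omega>. (simple_integral (N j) (\<tau> j) (\<xi> j) \<omega> - I \<omega>)\<^sup>2 \<partial>\<Omega>) \<longlonglongrightarrow> 0"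
    by (fact L2(2))
qed

lemma ito_square_integrable:
  fixes h :: "real \<Rightarrow> 'w \<Rightarrow> real"
  assumes "has_ito_integral h T I"
  shows "square_integrable \<Omega> I" "square_integrable (time_product T) (case_prod h)"
  using ito_approximation_exists[OF assms] ito_approximationD(2,3) by blast+

lemma ito_isometry:
  fixes h k :: "real \<Rightarrow> 'w \<Rightarrow> real"
  assumes h: "has_ito_integral h T I" and k: "has_ito_integral k T J"
  shows "expectation (\<lambda>\<omega>. I \<omega> * J \<omega>) = (\<integral>z. case_prod h z * case_prod k z \<partial>time_product T)"
proof -
  obtain N \<tau> \<xi> where A: "ito_approximation h T I N \<tau> \<xi>"
    using ito_approximation_exists[OF h] by blast
  obtain N' \<tau>' \<xi>' where A': "ito_approximation k T J N' \<tau>' \<xi>'"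
    using ito_approximation_exists[OF k] by blast
  note s = ito_approximationD(1)[OF A] and sq = ito_approximationD(2,3)[OF A]
    and lim = ito_approximationD(4,5)[OF A]
  note s' = ito_approximationD(1)[OF A'] and sq' = ito_approximationD(2,3)[OF A']
    and lim' = ito_approximationD(4,5)[OF A']
  have "(\<lambda>j. expectation (\<lambda>\<omega>. simple_integral (N j) (\<tau> j) (\<xi> j) \<omega> * simple_integral (N' j) (\<tau>' j) (\<xi>' j) \<omega>))
     \<longlonglongrightarrow> expectation (\<lambda>\<omega>. I \<omega> * J \<omega>)"
    by (rule L2_inner_tendsto[OF square_integrable_simple_integral[OF s] sq(2) lim(2)
          square_integrable_simple_integral[OF s'] sq'(2) lim'(2)])
  moreover have "(\<lambda>j. \<integral>z. case_prod (simple_process (N j) (\<tau> j) (\<xi> j)) z *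
        case_prod (simple_process (N' j) (\<tau>' j) (\<xi>' j)) z \<partial>time_product T)
     \<longlonglongrightarrow> (\<integral>z. case_prod h z * case_prod k z \<partial>time_product T)"
    by (rule L2_inner_tendsto[OF square_integrable_simple_process[OF s] sq(1) lim(1)
          square_integrable_simple_process[OF s'] sq'(1) lim'(1)])
  ultimately show ?thesis
    unfolding simple_integral_isometry[OF s s'] by (rule LIMSEQ_unique)
qed

lemma has_ito_integral_simple:
  fixes \<xi> :: "nat \<Rightarrow> 'w \<Rightarrow> real"
  assumes "simple_integrand T N \<tau> \<xi>"
  shows "has_ito_integral (simple_process N \<tau> \<xi>) T (simple_integral N \<tau> \<xi>)"
  unfolding has_ito_integral_def
  using square_integrable_simple_process[OF assms, of T] square_integrable_simple_integral[OF assms] assms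
  by (intro conjI exI[of _ "\<lambda>_. N"] exI[of _ "\<lambda>_. \<tau>"] exI[of _ "\<lambda>_. \<xi>"])
     (auto simp: square_integrable_def split_beta')

lemma ito_expectation_zero:
  fixes h :: "real \<Rightarrow> 'w \<Rightarrow> real"
  assumes h: "has_ito_integral h T I"
  shows "expectation I = 0"
proof -
  obtain N \<tau> \<xi> where A: "ito_approximation h T I N \<tau> \<xi>"
    using ito_approximation_exists[OF h] by blast
  note s = ito_approximationD(1)[OF A] and sq = ito_approximationD(3)[OF A]
    and lim = ito_approximationD(5)[OF A]
  have "(\<lambda>j. expectation (\<lambda>\<omega>. simple_integral (N j) (\<tau> j) (\<xi> j) \<omega> * 1)) \<longlonglongrightarrow> expectation (\<lambda>\<omega>. I \<omega> * 1)"
    by (rule L2_inner_tendsto[OF square_integrable_simple_integral[OF s] sq lim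
          square_integrable_const square_integrable_const]) simp
  moreover have "expectation (\<lambda>\<omega>. simple_integral (N j) (\<tau> j) (\<xi> j) \<omega> * 1) = 0" for j
  proof -
    note D = simple_integrandD[OF s[of j]]
    have t: "integrable \<Omega> (\<lambda>\<omega>. increment (\<tau> j k) (\<tau> j (Suc k)) \<omega> * \<xi> j k \<omega>) \<and>
       expectation (\<lambda>\<omega>. increment (\<tau> j k) (\<tau> j (Suc k)) \<omega> * \<xi> j k \<omega>) = 0" if k: "k < N j" for k
    proof -
      have "square_integrable \<Omega> (\<xi> j k)"
        using borel_measurable_F[OF D(1,4)[OF k]] D(5)[OF k] by (simp add: square_integrable_def)
      from past_times_increment(1,2)[OF D(1,2,4)[OF k] square_integrable_integrable[OF this]]
      show ?thesis by (simp add: mult.commute)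
    qed
    have "expectation (\<lambda>\<omega>. simple_integral (N j) (\<tau> j) (\<xi> j) \<omega>) =
      (\<Sum>k<N j. expectation (\<lambda>\<omega>. increment (\<tau> j k) (\<tau> j (Suc k)) \<omega> * \<xi> j k \<omega>))"
      unfolding simple_integral_def real_scaleR_def
      by (rule Bochner_Integration.integral_sum) (use t in auto)
    thus ?thesis using t by simp
  qed
  ultimately have "(\<lambda>j. 0) \<longlonglongrightarrow> expectation (\<lambda>\<omega>. I \<omega> * 1)" by (simp only:)
  from LIMSEQ_unique[OF tendsto_const this] show ?thesis by simp
qed

text \<open>
The values of a simple integrand that is stopped at time \<open>s\<close>. The nodes after \<open>s\<close> are moved to \<open>s\<close>;
the values that belong to them are only known later and are replaced by zero.
\<close>

definition stop_values :: "real \<Rightarrow> (nat \<Rightarrow> real) \<Rightarrow> (nat \<Rightarrow> 'w \<Rightarrow> real) \<Rightarrow> nat \<Rightarrow> 'w \<Rightarrow> real" where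
  "stop_values s \<tau> \<xi> k = (if \<tau> k < s then \<xi> k else (\<lambda>\<omega>. 0))"

lemma stopped_simple_integrand:
  assumes \<xi>: "simple_integrand T N \<tau> \<xi>" and s: "0 \<le> s" "s \<le> T"
  shows "simple_integrand s N (\<lambda>k. min (\<tau> k) s) (stop_values s \<tau> \<xi>)"
  using \<xi> s unfolding simple_integrand_def stop_values_def by (auto simp: min_def)

lemma stopped_simple_process:
  assumes "r \<le> s"
  shows "simple_process N (\<lambda>k. min (\<tau> k) s) (stop_values s \<tau> \<xi>) r \<omega> = simple_process N \<tau> \<xi> r \<omega>"
  unfolding simple_process_def
  by (intro sum.cong) (use assms in \<open>auto simp: stop_values_def indicator_def\<close>)

text \<open>
What stopping removes is a sum of increments after time \<open>s\<close>, each multiplied by quantities that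
are known when the increment starts.
\<close>

lemma stopped_simple_integral_inner:
  assumes \<xi>: "simple_integrand T N \<tau> \<xi>" and s: "0 \<le> s" "s \<le> T"
    and Z: "Z \<in> borel_measurable (F s)" "square_integrable \<Omega> Z"
  shows "expectation (\<lambda>\<omega>. simple_integral N \<tau> \<xi> \<omega> * Z \<omega>) =
    expectation (\<lambda>\<omega>. simple_integral N (\<lambda>k. min (\<tau> k) s) (stop_values s \<tau> \<xi>) \<omega> * Z \<omega>)"
proof -
  note D = simple_integrandD[OF \<xi>]
  have t: "integrable \<Omega> (\<lambda>\<omega>. Z \<omega> * \<xi> k \<omega> * increment (max (\<tau> k) s) (max (\<tau> (Suc k)) s) \<omega>) \<and>
       expectation (\<lambda>\<omega>. Z \<omega> * \<xi> k \<omega> * increment (max (\<tau> k) s) (max (\<tau> (Suc k)) s) \<omega>) = 0"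
    if k: "k < N" for k
  proof -
    have "square_integrable \<Omega> (\<xi> k)"
      using borel_measurable_F[OF D(1,4)[OF k]] D(5)[OF k] by (simp add: square_integrable_def)
    hence i: "integrable \<Omega> (\<lambda>\<omega>. Z \<omega> * \<xi> k \<omega>)" by (rule square_integrable_mult_integrable[OF Z(2)])
    have m: "(\<lambda>\<omega>. Z \<omega> * \<xi> k \<omega>) \<in> borel_measurable (F (max (\<tau> k) s))"
      using borel_measurable_F_mono[OF _ D(4)[OF k], of "max (\<tau> k) s"]
        borel_measurable_F_mono[OF _ Z(1), of "max (\<tau> k) s"] by simp
    show ?thesis
      using past_times_increment(1,2)[OF _ _ m i, of "max (\<tau> (Suc k)) s"] D(2)[OF k] s by auto
  qed
  have "simple_integral N \<tau> \<xi> \<omega> * Z \<omega> - simple_integral N (\<lambda>k. min (\<tau> k) s) (stop_values s \<tau> \<xi>) \<omega> * Z \<omega> =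
     (\<Sum>k<N. Z \<omega> * \<xi> k \<omega> * increment (max (\<tau> k) s) (max (\<tau> (Suc k)) s) \<omega>)" for \<omega>
    unfolding simple_integral_def left_diff_distrib[symmetric] sum_subtractf[symmetric] sum_distrib_right
  proof (intro sum.cong refl)
    fix k assume "k \<in> {..<N}"
    hence le: "\<tau> k \<le> \<tau> (Suc k)" using D(2) by simp
    show "((W (\<tau> (Suc k)) \<omega> - W (\<tau> k) \<omega>) *\<^sub>R \<xi> k \<omega>
        - (W (min (\<tau> (Suc k)) s) \<omega> - W (min (\<tau> k) s) \<omega>) *\<^sub>R stop_values s \<tau> \<xi> k \<omega>) * Z \<omega>
      = Z \<omega> * \<xi> k \<omega> * increment (max (\<tau> k) s) (max (\<tau> (Suc k)) s) \<omega>"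
    proof (cases "\<tau> k < s")
      case True
      thus ?thesis using le by (simp add: stop_values_def max_def min_def algebra_simps)
    next
      case False
      hence "max (\<tau> k) s = \<tau> k" "max (\<tau> (Suc k)) s = \<tau> (Suc k)" using le by auto
      with False show ?thesis by (simp add: stop_values_def)
    qed
  qed
  hence "expectation (\<lambda>\<omega>. simple_integral N \<tau> \<xi> \<omega> * Z \<omega> -
      simple_integral N (\<lambda>k. min (\<tau> k) s) (stop_values s \<tau> \<xi>) \<omega> * Z \<omega>) =
     expectation (\<lambda>\<omega>. \<Sum>k<N. Z \<omega> * \<xi> k \<omega> * increment (max (\<tau> k) s) (max (\<tau> (Suc k)) s) \<omega>)"
    by simp
  also have "\<dots> = (\<Sum>k<N. expectation (\<lambda>\<omega>. Z \<omega> * \<xi> k \<omega> * increment (max (\<tau> k) s) (max (\<tau> (Suc k)) s) \<omega>))"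
    by (rule Bochner_Integration.integral_sum) (use t in auto)
  also have "\<dots> = 0" using t by simp
  finally show ?thesis
    using square_integrable_mult_integrable[OF square_integrable_simple_integral[OF \<xi>] Z(2)]
      square_integrable_mult_integrable[OF
        square_integrable_simple_integral[OF stopped_simple_integrand[OF \<xi> s]] Z(2)]
    by simp
qed

text \<open>
The two integrals are defined by unrelated approximating sequences. The approximations of the
longer integral, stopped at \<open>s\<close>, still approximate the integrand on \<open>{0..s}\<close>, so by the isometry
their integrals converge to the shorter integral \<open>J\<close>. The claim holds for simple integrands and
passes to the limit.
\<close>

lemma ito_martingale:
  fixes h :: "real \<Rightarrow> 'w \<Rightarrow> real"
  assumes T: "has_ito_integral h T I" and s: "has_ito_integral h s J" "0 \<le> s" "s \<le> T"
    and Z: "Z \<in> borel_measurable (F s)" "square_integrable \<Omega> Z"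
  shows "expectation (\<lambda>\<omega>. I \<omega> * Z \<omega>) = expectation (\<lambda>\<omega>. J \<omega> * Z \<omega>)"
proof -
  obtain N \<tau> \<xi> where A: "ito_approximation h T I N \<tau> \<xi>"
    using ito_approximation_exists[OF T] by blast
  note sim = ito_approximationD(1)[OF A] and sq = ito_approximationD(2,3)[OF A]
    and lim = conjunct1[OF conjunct2[OF conjunct2[OF conjunct2[OF A[unfolded ito_approximation_def]]]]]
      ito_approximationD(5)[OF A]
  define S where "S j = simple_integral (N j) (\<lambda>k. min (\<tau> j k) s) (stop_values s (\<tau> j) (\<xi> j))" for j
  define p where "p j = simple_process (N j) (\<lambda>k. min (\<tau> j k) s) (stop_values s (\<tau> j) (\<xi> j))" for j
  (* A simple integrand is its own approximation, so the isometry covers S j and J together. *)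
  have ito: "has_ito_integral (p j) s (S j)" for j
    unfolding p_def S_def by (intro has_ito_integral_simple stopped_simple_integrand[OF sim] s)
  note q = ito_square_integrable[OF ito] and qJ = ito_square_integrable[OF s(1)]
  have "(\<integral>\<omega>. (S j \<omega> - J \<omega>)\<^sup>2 \<partial>\<Omega>) = (\<integral>z. (case_prod (p j) z - case_prod h z)\<^sup>2 \<partial>time_product s)" for j
  proof -
    note mm = square_integrable_mult_integrable
    have "(\<integral>\<omega>. (S j \<omega> - J \<omega>)\<^sup>2 \<partial>\<Omega>) = (\<integral>\<omega>. S j \<omega> * S j \<omega> - 2 * (S j \<omega> * J \<omega>) + J \<omega> * J \<omega> \<partial>\<Omega>)"
      by (intro Bochner_Integration.integral_cong) (auto simp: power2_eq_square algebra_simps)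
    also have "\<dots> = (\<integral>\<omega>. S j \<omega> * S j \<omega> \<partial>\<Omega>) - 2 * (\<integral>\<omega>. S j \<omega> * J \<omega> \<partial>\<Omega>) + (\<integral>\<omega>. J \<omega> * J \<omega> \<partial>\<Omega>)"
      using mm[OF q(1)[of j] q(1)[of j]] mm[OF q(1)[of j] qJ(1)] mm[OF qJ(1) qJ(1)] by simp
    also have "\<dots> = (\<integral>z. case_prod (p j) z * case_prod (p j) z \<partial>time_product s)
        - 2 * (\<integral>z. case_prod (p j) z * case_prod h z \<partial>time_product s)
        + (\<integral>z. case_prod h z * case_prod h z \<partial>time_product s)"
      by (simp only: ito_isometry[OF ito ito] ito_isometry[OF ito s(1)] ito_isometry[OF s(1) s(1)])
    also have "\<dots> = (\<integral>z. case_prod (p j) z * case_prod (p j) z - 2 * (case_prod (p j) z * case_prod h z)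
        + case_prod h z * case_prod h z \<partial>time_product s)"
      using mm[OF q(2)[of j] q(2)[of j]] mm[OF q(2)[of j] qJ(2)] mm[OF qJ(2) qJ(2)] by simp
    also have "\<dots> = (\<integral>z. (case_prod (p j) z - case_prod h z)\<^sup>2 \<partial>time_product s)"
      by (intro Bochner_Integration.integral_cong refl) (simp add: case_prod_beta power2_eq_square algebra_simps)
    finally show ?thesis .
  qed
  moreover have "(\<lambda>j. \<integral>z. (case_prod (p j) z - case_prod h z)\<^sup>2 \<partial>time_product s) \<longlonglongrightarrow> 0"
  proof (rule L2_limit(2)[OF q(2) square_integrable_measurable[OF qJ(2)]])
    have "(\<integral>\<^sup>+z. ennreal ((case_prod h z - case_prod (p j) z)\<^sup>2) \<partial>time_product s) \<le>
      (\<integral>\<^sup>+z. ennreal ((case_prod h z - case_prod (simple_process (N j) (\<tau> j) (\<xi> j)) z)\<^sup>2)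
           \<partial>time_product T)" for j
    proof -
      have "(\<integral>\<^sup>+z. ennreal ((case_prod h z - case_prod (p j) z)\<^sup>2) \<partial>time_product s) =
        (\<integral>\<^sup>+z. ennreal ((case_prod h z - case_prod (simple_process (N j) (\<tau> j) (\<xi> j)) z)\<^sup>2)
           \<partial>time_product s)"
        by (intro nn_integral_cong)
           (auto simp: p_def stopped_simple_process space_pair_measure space_restrict_space)
      also have "\<dots> \<le> (\<integral>\<^sup>+z. ennreal ((case_prod h z - case_prod (simple_process (N j) (\<tau> j) (\<xi> j)) z)\<^sup>2)
           \<partial>time_product T)"
        by (rule nn_integral_time_product_mono[OF s(3)])
           (use sq(1) square_integrable_simple_process[OF sim, of T j] in \<open>auto simp: square_integrable_def\<close>)
      finally show ?thesis .
    qed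
    thus "(\<lambda>j. \<integral>\<^sup>+z. ennreal ((case_prod h z - case_prod (p j) z)\<^sup>2) \<partial>time_product s) \<longlonglongrightarrow> 0"
      by (intro tendsto_sandwich[OF _ _ tendsto_const lim(1)] always_eventually) auto
  qed
  ultimately have "(\<lambda>j. \<integral>\<omega>. (S j \<omega> - J \<omega>)\<^sup>2 \<partial>\<Omega>) \<longlonglongrightarrow> 0" by simp
  from L2_inner_tendsto[OF q(1) qJ(1) this Z(2) Z(2)]
  have "(\<lambda>j. expectation (\<lambda>\<omega>. S j \<omega> * Z \<omega>)) \<longlonglongrightarrow> expectation (\<lambda>\<omega>. J \<omega> * Z \<omega>)" by simp
  moreover have "(\<lambda>j. expectation (\<lambda>\<omega>. simple_integral (N j) (\<tau> j) (\<xi> j) \<omega> * Z \<omega>))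
      \<longlonglongrightarrow> expectation (\<lambda>\<omega>. I \<omega> * Z \<omega>)"
    using L2_inner_tendsto[OF square_integrable_simple_integral[OF sim] sq(2) lim(2) Z(2) Z(2)] by simp
  ultimately show ?thesis
    unfolding stopped_simple_integral_inner[OF sim s(2,3) Z] S_def by (rule LIMSEQ_unique[rotated])
qed

end


section \<open>The product rule in expectation\<close>

lemma time_interval_ident_measurable: "(\<lambda>x. x) \<in> borel_measurable (time_interval T)"
  by (rule measurable_restrict_space1) simp

lemma initial_segment_indicator_measurable:
  "(\<lambda>z. indicator {..fst z} (snd z) :: real) \<in> borel_measurable (time_interval T \<Otimes>\<^sub>M time_interval T)"
proof -
  note [measurable] = time_interval_ident_measurable
  have [measurable]: "fst \<in> borel_measurable (time_interval T \<Otimes>\<^sub>M time_interval T)"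
    "snd \<in> borel_measurable (time_interval T \<Otimes>\<^sub>M time_interval T)"
    using measurable_compose[OF measurable_fst time_interval_ident_measurable]
      measurable_compose[OF measurable_snd time_interval_ident_measurable] by auto
  have eq: "(\<lambda>z. indicator {..fst z} (snd z) :: real) = (\<lambda>z. if snd z \<le> fst z then 1 else 0)"
    by (auto simp: indicator_def)
  show ?thesis unfolding eq by measurable
qed

text \<open>
Fubini's theorem on a square that is cut along its diagonal, which is a null set.
\<close>

lemma product_of_integrals:
  fixes p q :: "real \<Rightarrow> real"
  assumes p: "integrable (time_interval T) p" and q: "integrable (time_interval T) q"
  defines "P \<equiv> \<lambda>s. \<integral>r. indicator {..s} r * p r \<partial>time_interval T"
    and "Q \<equiv> \<lambda>s. \<integral>r. indicator {..s} r * q r \<partial>time_interval T"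
  shows "(\<integral>r. p r \<partial>time_interval T) * (\<integral>r. q r \<partial>time_interval T) =
    (\<integral>s. p s * Q s + P s * q s \<partial>time_interval T)"
proof -
  let ?R = "time_interval T"
  interpret R: finite_measure ?R by (rule finite_time_interval)
  interpret RR: pair_sigma_finite ?R ?R ..
  have i: "integrable (?R \<Otimes>\<^sub>M ?R) (\<lambda>z. p (fst z) * q (snd z))"
    using integral_pair_product(1)[OF RR.pair_sigma_finite_axioms p q] by (simp add: split_beta')
  note [measurable] = initial_segment_indicator_measurable[of T]
  have [measurable]: "p \<in> borel_measurable ?R" "q \<in> borel_measurable ?R" using p q by auto
  have i1: "integrable (?R \<Otimes>\<^sub>M ?R) (\<lambda>z. indicator {..fst z} (snd z) * (p (fst z) * q (snd z)))"
    by (rule Bochner_Integration.integrable_bound[OF i], measurable, rule AE_I2) (auto simp: indicator_def)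
  have i2: "integrable (?R \<Otimes>\<^sub>M ?R) (\<lambda>z. (1 - indicator {..fst z} (snd z)) * (p (fst z) * q (snd z)))"
    by (rule Bochner_Integration.integrable_bound[OF i], measurable, rule AE_I2) (auto simp: indicator_def)
  note i1' = i1[unfolded split_beta'[of "\<lambda>s r. indicator {..s} r * (p s * q r)", symmetric]]
  note i2' = i2[unfolded split_beta'[of "\<lambda>s r. (1 - indicator {..s} r) * (p s * q r)", symmetric]]
  have e1: "(\<integral>r. indicator {..s} r * (p s * q r) \<partial>?R) = p s * Q s" for s
  proof -
    have "(\<integral>r. indicator {..s} r * (p s * q r) \<partial>?R) = (\<integral>r. p s * (indicator {..s} r * q r) \<partial>?R)"
      by (simp add: mult.left_commute)
    thus ?thesis unfolding Q_def by (simp only: integral_mult_right_zero)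
  qed
  have e2: "(\<integral>s. (1 - indicator {..s} r) * (p s * q r) \<partial>?R) = P r * q r" for r
  proof -
    (* Replacing {..<r} by {..r} adds one point. *)
    have ne: "AE s in ?R. s \<noteq> r"
      by (subst AE_restrict_space_iff) (use AE_lborel_singleton[of r] in auto)
    have "(\<lambda>s. (1 - indicator {..s} r) * (p s * q r)) = (\<lambda>s. indicator {..<r} s * (p s * q r))"
      by (auto simp: indicator_def)
    moreover have "(\<integral>s. indicator {..<r} s * (p s * q r) \<partial>?R) = (\<integral>s. indicator {..r} s * p s * q r \<partial>?R)"
    proof (rule integral_cong_AE)
      have [measurable]: "(indicator {..<r} :: real \<Rightarrow> real) \<in> borel_measurable ?R"
          "(indicator {..r} :: real \<Rightarrow> real) \<in> borel_measurable ?R"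
        by (rule measurable_restrict_space1; simp)+
      show "(\<lambda>s. indicator {..<r} s * (p s * q r)) \<in> borel_measurable ?R"
        "(\<lambda>s. indicator {..r} s * p s * q r) \<in> borel_measurable ?R" by measurable
      show "AE s in ?R. indicator {..<r} s * (p s * q r) = indicator {..r} s * p s * q r"
        using ne by eventually_elim (auto simp: indicator_def)
    qed
    moreover have "\<dots> = P r * q r" unfolding P_def by (rule integral_mult_left_zero)
    ultimately show ?thesis by simp
  qed
  have "(\<integral>r. p r \<partial>?R) * (\<integral>r. q r \<partial>?R) = (\<integral>z. p (fst z) * q (snd z) \<partial>(?R \<Otimes>\<^sub>M ?R))"
    using integral_pair_product(2)[OF RR.pair_sigma_finite_axioms p q] by (simp add: split_beta')
  also have "\<dots> = (\<integral>z. indicator {..fst z} (snd z) * (p (fst z) * q (snd z))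
     + (1 - indicator {..fst z} (snd z)) * (p (fst z) * q (snd z)) \<partial>(?R \<Otimes>\<^sub>M ?R))"
    by (simp add: algebra_simps)
  also have "\<dots> = (\<integral>z. indicator {..fst z} (snd z) * (p (fst z) * q (snd z)) \<partial>(?R \<Otimes>\<^sub>M ?R))
     + (\<integral>z. (1 - indicator {..fst z} (snd z)) * (p (fst z) * q (snd z)) \<partial>(?R \<Otimes>\<^sub>M ?R))"
    by (rule Bochner_Integration.integral_add[OF i1 i2])
  also have "\<dots> = (\<integral>s. p s * Q s \<partial>?R) + (\<integral>r. P r * q r \<partial>?R)"
    using RR.integral_fst[OF i1'] RR.integral_snd[OF i2'] by (simp add: e1 e2 split_beta')
  also have "\<dots> = (\<integral>s. p s * Q s + P s * q s \<partial>?R)"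
    using RR.integrable_fst[OF i1'] RR.integrable_snd[OF i2']
    by (simp add: e1 e2)
  finally show ?thesis .
qed

context brownian_motion
begin

text \<open>
The primitive of \<open>b\<close>, written for all \<open>s\<close> as an integral over the same interval \<open>{0..T}\<close>, so that
its joint measurability is that of a parametrized integral.
\<close>

definition running_integral :: "real \<Rightarrow> (real \<Rightarrow> 'w \<Rightarrow> real) \<Rightarrow> real \<Rightarrow> 'w \<Rightarrow> real" where
  "running_integral T b s \<omega> = (\<integral>r. indicator {..s} r * b r \<omega> \<partial>time_interval T)"

lemma running_integral_full: "running_integral T b T \<omega> = (\<integral>r. b r \<omega> \<partial>time_interval T)"
  unfolding running_integral_def
  by (intro Bochner_Integration.integral_cong) (auto simp: space_restrict_space)

lemma square_integrable_sections:
  assumes b: "square_integrable (time_product T) (case_prod b)"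
  shows "AE \<omega> in \<Omega>. square_integrable (time_interval T) (\<lambda>s. b s \<omega>)"
    and "AE s in time_interval T. square_integrable \<Omega> (b s)"
    and "s \<in> {0..T} \<Longrightarrow> b s \<in> borel_measurable \<Omega>"
proof -
  interpret P: pair_sigma_finite "time_interval T" \<Omega> by (rule pair_sigma_finite_time_product)
  have m: "case_prod b \<in> borel_measurable (time_product T)"
    and i: "integrable (time_product T) (case_prod (\<lambda>s \<omega>. (b s \<omega>)\<^sup>2))"
    using b by (auto simp: square_integrable_def split_beta')
  have m1: "(\<lambda>s. b s \<omega>) \<in> borel_measurable (time_interval T)" if "\<omega> \<in> space \<Omega>" for \<omega>
    using measurable_Pair1[OF m that] by simp
  have m2: "b s \<in> borel_measurable \<Omega>" if "s \<in> space (time_interval T)" for s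
    using measurable_Pair2[OF m that] by simp
  show "AE \<omega> in \<Omega>. square_integrable (time_interval T) (\<lambda>s. b s \<omega>)"
    using P.AE_integrable_snd[OF i] AE_space by eventually_elim (auto simp: square_integrable_def m1)
  show "AE s in time_interval T. square_integrable \<Omega> (b s)"
    using P.AE_integrable_fst[OF i] AE_space by eventually_elim (auto simp: square_integrable_def m2)
  show "s \<in> {0..T} \<Longrightarrow> b s \<in> borel_measurable \<Omega>" using m2 by (simp add: space_restrict_space)
qed

lemma running_integral_measurable:
  assumes b: "square_integrable (time_product T) (case_prod b)"
  shows "case_prod (running_integral T b) \<in> borel_measurable (time_product T)"
proof -
  let ?R = "time_interval T"
  interpret R: finite_measure ?R by (rule finite_time_interval)
  have m1: "(\<lambda>w. indicator {..fst (fst w)} (snd w) :: real) \<in> borel_measurable ((?R \<Otimes>\<^sub>M \<Omega>) \<Otimes>\<^sub>M ?R)"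
    using measurable_compose[OF _ initial_segment_indicator_measurable[of T],
        of "\<lambda>w. (fst (fst w), snd w)" "(?R \<Otimes>\<^sub>M \<Omega>) \<Otimes>\<^sub>M ?R"] by simp
  have m2: "(\<lambda>w. b (snd w) (snd (fst w))) \<in> borel_measurable ((?R \<Otimes>\<^sub>M \<Omega>) \<Otimes>\<^sub>M ?R)"
    using measurable_compose[OF _ square_integrable_measurable[OF b],
        of "\<lambda>w. (snd w, snd (fst w))" "(?R \<Otimes>\<^sub>M \<Omega>) \<Otimes>\<^sub>M ?R"] by simp
  have "(\<lambda>(z, r). indicator {..fst z} r * b r (snd z)) \<in> borel_measurable ((?R \<Otimes>\<^sub>M \<Omega>) \<Otimes>\<^sub>M ?R)"
    using borel_measurable_times[OF m1 m2] by (simp add: split_beta')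
  from R.borel_measurable_lebesgue_integral[OF this]
  show ?thesis by (simp add: running_integral_def split_beta')
qed

text \<open>
The Cauchy-Schwarz inequality in time bounds the square of the integral by \<open>T\<close> times the
integral of the square. The result serves as a bound for all primitives at once.
\<close>

lemma square_integrable_absolute_integral:
  assumes b: "square_integrable (time_product T) (case_prod b)"
  shows "square_integrable \<Omega> (\<lambda>\<omega>. \<integral>r. \<bar>b r \<omega>\<bar> \<partial>time_interval T)"
proof -
  let ?R = "time_interval T"
  interpret R: finite_measure ?R by (rule finite_time_interval)
  interpret P: pair_sigma_finite "time_interval T" \<Omega> by (rule pair_sigma_finite_time_product)
  have m: "case_prod b \<in> borel_measurable (time_product T)"
    and i: "integrable (time_product T) (case_prod (\<lambda>s \<omega>. (b s \<omega>)\<^sup>2))"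
    using b by (auto simp: square_integrable_def split_beta')
  have "(\<lambda>(\<omega>, r). \<bar>b r \<omega>\<bar>) \<in> borel_measurable (\<Omega> \<Otimes>\<^sub>M ?R)"
    using measurable_compose[OF measurable_pair_swap' m] by (simp add: split_beta')
  from R.borel_measurable_lebesgue_integral[OF this]
  have Km: "(\<lambda>\<omega>. \<integral>r. \<bar>b r \<omega>\<bar> \<partial>?R) \<in> borel_measurable \<Omega>" .
  have "integrable \<Omega> (\<lambda>\<omega>. (\<integral>r. \<bar>b r \<omega>\<bar> \<partial>?R)\<^sup>2)"
  proof (rule Bochner_Integration.integrable_bound)
    show "integrable \<Omega> (\<lambda>\<omega>. measure ?R (space ?R) * (\<integral>r. (b r \<omega>)\<^sup>2 \<partial>?R))"
      using P.integrable_snd[OF i] by simp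
    show "AE \<omega> in \<Omega>. norm ((\<integral>r. \<bar>b r \<omega>\<bar> \<partial>?R)\<^sup>2) \<le> norm (measure ?R (space ?R) * (\<integral>r. (b r \<omega>)\<^sup>2 \<partial>?R))"
      using square_integrable_sections(1)[OF b]
    proof eventually_elim
      fix \<omega> assume s: "square_integrable ?R (\<lambda>s. b s \<omega>)"
      hence "square_integrable ?R (\<lambda>s. \<bar>b s \<omega>\<bar>)" by (auto simp: square_integrable_def)
      from Cauchy_Schwarz_integral[OF R.square_integrable_const[of 1] this]
      show "norm ((\<integral>r. \<bar>b r \<omega>\<bar> \<partial>?R)\<^sup>2) \<le> norm (measure ?R (space ?R) * (\<integral>r. (b r \<omega>)\<^sup>2 \<partial>?R))"
        by simp
    qed
  qed (use Km in simp)
  with Km show ?thesis by (simp add: square_integrable_def)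
qed

lemma running_integral_bound:
  assumes b: "square_integrable (time_product T) (case_prod b)"
  shows "AE \<omega> in \<Omega>. \<forall>s. \<bar>running_integral T b s \<omega>\<bar> \<le> (\<integral>r. \<bar>b r \<omega>\<bar> \<partial>time_interval T)"
  using square_integrable_sections(1)[OF b]
proof eventually_elim
  fix \<omega> assume "square_integrable (time_interval T) (\<lambda>s. b s \<omega>)"
  hence i: "integrable (time_interval T) (\<lambda>s. b s \<omega>)"
    using finite_measure.square_integrable_integrable[OF finite_time_interval] by blast
  have "\<bar>running_integral T b s \<omega>\<bar> \<le> (\<integral>r. \<bar>b r \<omega>\<bar> \<partial>time_interval T)" for s
  proof -
    have [measurable]: "(indicator {..s} :: real \<Rightarrow> real) \<in> borel_measurable (time_interval T)"
      by (rule measurable_restrict_space1) simp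
    have "integrable (time_interval T) (\<lambda>r. indicator {..s} r * b r \<omega>)"
      using borel_measurable_integrable[OF i]
      by (intro Bochner_Integration.integrable_bound[OF i] AE_I2) (measurable, auto simp: indicator_def)
    hence "norm (running_integral T b s \<omega>) \<le> (\<integral>r. norm (indicator {..s} r * b r \<omega>) \<partial>time_interval T)"
      unfolding running_integral_def by (intro integral_norm_bound)
    also have "\<dots> \<le> (\<integral>r. \<bar>b r \<omega>\<bar> \<partial>time_interval T)"
      by (rule integral_mono) (use i \<open>integrable _ (\<lambda>r. indicator {..s} r * b r \<omega>)\<close> in \<open>auto simp: indicator_def\<close>)
    finally show ?thesis by simp
  qed
  thus "\<forall>s. \<bar>running_integral T b s \<omega>\<bar> \<le> (\<integral>r. \<bar>b r \<omega>\<bar> \<partial>time_interval T)" by blast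
qed

lemma square_integrable_const_in_time:
  assumes Z: "square_integrable \<Omega> Z"
  shows "square_integrable (time_product T) (\<lambda>z. Z (snd z))"
proof -
  interpret R: finite_measure "time_interval T" by (rule finite_time_interval)
  have [measurable]: "Z \<in> borel_measurable \<Omega>" using Z by (simp add: square_integrable_def)
  have "integrable (time_product T) (\<lambda>(s, \<omega>). 1 * (Z \<omega>)\<^sup>2)"
    by (rule integral_pair_product(1)[OF pair_sigma_finite_time_product])
       (use Z in \<open>auto simp: square_integrable_def\<close>)
  thus ?thesis by (simp add: square_integrable_def split_beta')
qed

lemma square_integrable_running_integral:
  assumes b: "square_integrable (time_product T) (case_prod b)"
  shows "square_integrable (time_product T) (case_prod (running_integral T b))"
    and "s \<in> {0..T} \<Longrightarrow> square_integrable \<Omega> (running_integral T b s)"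
proof -
  let ?K = "\<lambda>\<omega>. \<integral>r. \<bar>b r \<omega>\<bar> \<partial>time_interval T"
  note K = square_integrable_absolute_integral[OF b]
  interpret P: pair_sigma_finite "time_interval T" \<Omega> by (rule pair_sigma_finite_time_product)
  note m[measurable] = running_integral_measurable[OF b]
  show "square_integrable \<Omega> (running_integral T b s)" if s: "s \<in> {0..T}"
  proof (rule square_integrable_bound[OF K])
    have "s \<in> space (time_interval T)" using s by (simp add: space_restrict_space)
    from measurable_Pair2[OF m this] show "running_integral T b s \<in> borel_measurable \<Omega>" by simp
    show "AE \<omega> in \<Omega>. \<bar>running_integral T b s \<omega>\<bar> \<le> \<bar>?K \<omega>\<bar>"
      using running_integral_bound[OF b] by eventually_elim (auto intro: order_trans[OF _ abs_ge_self])
  qed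
  show "square_integrable (time_product T) (case_prod (running_integral T b))"
  proof (rule square_integrable_bound[OF square_integrable_const_in_time[OF K] m])
    have [measurable]: "?K \<in> borel_measurable \<Omega>" using K by (simp add: square_integrable_def)
    show "AE z in time_product T. \<bar>case_prod (running_integral T b) z\<bar> \<le> \<bar>?K (snd z)\<bar>"
    proof (rule P.AE_pair_measure)
      show "{z \<in> space (time_product T). \<bar>case_prod (running_integral T b) z\<bar> \<le> \<bar>?K (snd z)\<bar>} \<in> sets (time_product T)"
        by measurable
      have "AE \<omega> in \<Omega>. \<bar>running_integral T b s \<omega>\<bar> \<le> \<bar>?K \<omega>\<bar>" for s
        using running_integral_bound[OF b] by eventually_elim (auto intro: order_trans[OF _ abs_ge_self])
      thus "AE s in time_interval T. AE \<omega> in \<Omega>.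
          \<bar>case_prod (running_integral T b) (s, \<omega>)\<bar> \<le> \<bar>?K (snd (s, \<omega>))\<bar>" by simp
    qed
  qed
qed

lemma running_integral_inner:
  assumes b: "square_integrable (time_product T) (case_prod b)" and Z: "square_integrable \<Omega> Z"
  shows "expectation (\<lambda>\<omega>. running_integral T b T \<omega> * Z \<omega>) = (\<integral>s. expectation (\<lambda>\<omega>. b s \<omega> * Z \<omega>) \<partial>time_interval T)"
    and "expectation (\<lambda>\<omega>. running_integral T b T \<omega> * Z \<omega>) = (\<integral>z. case_prod b z * Z (snd z) \<partial>time_product T)"
proof -
  interpret P: pair_sigma_finite "time_interval T" \<Omega> by (rule pair_sigma_finite_time_product)
  have "integrable (time_product T) (\<lambda>z. case_prod b z * Z (snd z))"
    by (rule square_integrable_mult_integrable[OF b square_integrable_const_in_time[OF Z]])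
  hence i: "integrable (time_product T) (case_prod (\<lambda>s \<omega>. b s \<omega> * Z \<omega>))"
    by (simp add: split_beta')
  have "(\<integral>r. b r \<omega> * Z \<omega> \<partial>time_interval T) = running_integral T b T \<omega> * Z \<omega>" for \<omega>
    unfolding running_integral_full by simp
  with P.integral_fst[OF i] P.integral_snd[OF i]
  show "expectation (\<lambda>\<omega>. running_integral T b T \<omega> * Z \<omega>) = (\<integral>s. expectation (\<lambda>\<omega>. b s \<omega> * Z \<omega>) \<partial>time_interval T)"
    and "expectation (\<lambda>\<omega>. running_integral T b T \<omega> * Z \<omega>) = (\<integral>z. case_prod b z * Z (snd z) \<partial>time_product T)"
    by (simp_all only: split_beta' fst_conv snd_conv)
qed

text \<open>
The pathwise product rule for the primitives, integrated over the probability space.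
\<close>

lemma running_integrals_inner:
  assumes b: "square_integrable (time_product T) (case_prod b)"
    and c: "square_integrable (time_product T) (case_prod c)" and "0 \<le> T"
  shows "expectation (\<lambda>\<omega>. running_integral T b T \<omega> * running_integral T c T \<omega>) =
    (\<integral>z. case_prod b z * case_prod (running_integral T c) z
       + case_prod (running_integral T b) z * case_prod c z \<partial>time_product T)"
proof -
  interpret P: pair_sigma_finite "time_interval T" \<Omega> by (rule pair_sigma_finite_time_product)
  let ?f = "\<lambda>s \<omega>. b s \<omega> * running_integral T c s \<omega> + running_integral T b s \<omega> * c s \<omega>"
  have "integrable (time_product T) (\<lambda>z. case_prod b z * case_prod (running_integral T c) z
       + case_prod (running_integral T b) z * case_prod c z)"
    by (intro Bochner_Integration.integrable_add square_integrable_mult_integrable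
        square_integrable_running_integral b c)
  hence i: "integrable (time_product T) (case_prod ?f)" by (simp add: split_beta')
  have "AE \<omega> in \<Omega>. running_integral T b T \<omega> * running_integral T c T \<omega> = (\<integral>s. ?f s \<omega> \<partial>time_interval T)"
    using square_integrable_sections(1)[OF b] square_integrable_sections(1)[OF c]
  proof eventually_elim
    fix \<omega> assume "square_integrable (time_interval T) (\<lambda>s. b s \<omega>)"
      "square_integrable (time_interval T) (\<lambda>s. c s \<omega>)"
    hence "integrable (time_interval T) (\<lambda>s. b s \<omega>)" "integrable (time_interval T) (\<lambda>s. c s \<omega>)"
      using finite_measure.square_integrable_integrable[OF finite_time_interval] by blast+
    from product_of_integrals[OF this]
    show "running_integral T b T \<omega> * running_integral T c T \<omega> = (\<integral>s. ?f s \<omega> \<partial>time_interval T)"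
      by (simp add: running_integral_full running_integral_def)
  qed
  moreover have "(\<lambda>\<omega>. running_integral T b T \<omega> * running_integral T c T \<omega>) \<in> borel_measurable \<Omega>"
    using square_integrable_running_integral(2)[OF b, of T, THEN square_integrable_measurable]
      square_integrable_running_integral(2)[OF c, of T, THEN square_integrable_measurable] \<open>0 \<le> T\<close>
    by (intro borel_measurable_times) auto
  moreover have "(\<lambda>\<omega>. \<integral>s. ?f s \<omega> \<partial>time_interval T) \<in> borel_measurable \<Omega>"
    using P.integrable_snd[OF i] by (rule borel_measurable_integrable)
  ultimately have "expectation (\<lambda>\<omega>. running_integral T b T \<omega> * running_integral T c T \<omega>) =
      expectation (\<lambda>\<omega>. \<integral>s. ?f s \<omega> \<partial>time_interval T)"
    by (intro integral_cong_AE) auto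
  also have "\<dots> = (\<integral>z. case_prod ?f z \<partial>time_product T)" by (rule P.integral_snd[OF i])
  finally show ?thesis by (simp add: split_beta')
qed

text \<open>
Real processes \<open>du = b dt + h dW\<close>, \<open>u(0) = u0\<close>. The Ito integral is asserted for each time
separately, as in the definition of a solution.
\<close>

definition ito_process ::
  "real \<Rightarrow> real \<Rightarrow> (real \<Rightarrow> 'w \<Rightarrow> real) \<Rightarrow> (real \<Rightarrow> 'w \<Rightarrow> real) \<Rightarrow> (real \<Rightarrow> 'w \<Rightarrow> real) \<Rightarrow> bool" where
  "ito_process T u0 b h u \<longleftrightarrow>
     square_integrable (time_product T) (case_prod b) \<and>
     square_integrable (time_product T) (case_prod u) \<and>
     (\<forall>s\<in>{0..T}. b s \<in> borel_measurable (F s)) \<and>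
     (\<forall>s\<in>{0..T}. \<exists>I. has_ito_integral h s I \<and>
        (AE \<omega> in \<Omega>. u s \<omega> = u0 + running_integral T b s \<omega> + I \<omega>))"

lemma ito_processD:
  assumes "ito_process T u0 b h u"
  shows "square_integrable (time_product T) (case_prod b)"
    and "square_integrable (time_product T) (case_prod u)"
    and "\<And>s. s \<in> {0..T} \<Longrightarrow> b s \<in> borel_measurable (F s)"
    and "\<And>s. s \<in> {0..T} \<Longrightarrow> \<exists>I. has_ito_integral h s I \<and>
        (AE \<omega> in \<Omega>. u s \<omega> = u0 + running_integral T b s \<omega> + I \<omega>)"
  using assms unfolding ito_process_def by blast+

text \<open>
By Fubini's theorem the left-hand side is the time integral of \<open>\<bbbE>(b(s) J)\<close>. Since \<open>b(s)\<close> is known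
at time \<open>s\<close>, the martingale property replaces \<open>J\<close> by the Ito integral up to time \<open>s\<close>, which is
\<open>v(s) - v0 - \<integral>\<^sub>0\<^sup>s c\<close>.
\<close>

lemma drift_times_ito_integral:
  assumes b: "square_integrable (time_product T) (case_prod b)"
      "\<And>s. s \<in> {0..T} \<Longrightarrow> b s \<in> borel_measurable (F s)"
    and v: "ito_process T v0 c k v" and J: "has_ito_integral k T J"
  shows "expectation (\<lambda>\<omega>. running_integral T b T \<omega> * J \<omega>) =
    (\<integral>z. case_prod b z * (case_prod v z - v0 - case_prod (running_integral T c) z) \<partial>time_product T)"
proof -
  interpret P: pair_sigma_finite "time_interval T" \<Omega> by (rule pair_sigma_finite_time_product)
  interpret PF: finite_measure "time_product T"
    by (intro finite_measure_pair_measure finite_time_interval finite_measure_axioms)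
  note c = ito_processD(1)[OF v] and vq = ito_processD(2)[OF v]
  let ?w = "\<lambda>s \<omega>. v s \<omega> - v0 - running_integral T c s \<omega>"
  have wq: "square_integrable (time_product T) (case_prod ?w)"
    using square_integrable_diff[OF square_integrable_diff[OF vq PF.square_integrable_const[of v0]]
        square_integrable_running_integral(1)[OF c]] by (simp add: split_beta')
  have i: "integrable (time_product T) (case_prod (\<lambda>s \<omega>. b s \<omega> * ?w s \<omega>))"
    using square_integrable_mult_integrable[OF b(1) wq] by (simp add: split_beta')
  have bm: "AE s in time_interval T. expectation (\<lambda>\<omega>. b s \<omega> * J \<omega>) = expectation (\<lambda>\<omega>. b s \<omega> * ?w s \<omega>)"
    using square_integrable_sections(2)[OF b(1)] square_integrable_sections(2)[OF wq] AE_space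
  proof eventually_elim
    fix s assume bs: "square_integrable \<Omega> (b s)" and ws: "square_integrable \<Omega> (?w s)"
      and "s \<in> space (time_interval T)"
    hence s: "0 \<le> s" "s \<le> T" by (auto simp: space_restrict_space)
    then obtain Js where Js: "has_ito_integral k s Js"
      "AE \<omega> in \<Omega>. v s \<omega> = v0 + running_integral T c s \<omega> + Js \<omega>"
      using ito_processD(4)[OF v, of s] by auto
    have "expectation (\<lambda>\<omega>. J \<omega> * b s \<omega>) = expectation (\<lambda>\<omega>. Js \<omega> * b s \<omega>)"
      using ito_martingale[OF J Js(1) s b(2) bs] s by simp
    also have "\<dots> = expectation (\<lambda>\<omega>. ?w s \<omega> * b s \<omega>)"
    proof (rule integral_cong_AE)
      show "(\<lambda>\<omega>. Js \<omega> * b s \<omega>) \<in> borel_measurable \<Omega>" "(\<lambda>\<omega>. ?w s \<omega> * b s \<omega>) \<in> borel_measurable \<Omega>"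
        by (intro borel_measurable_times square_integrable_measurable bs ws
            ito_square_integrable(1)[OF Js(1)])+
      show "AE \<omega> in \<Omega>. Js \<omega> * b s \<omega> = ?w s \<omega> * b s \<omega>" using Js(2) by eventually_elim simp
    qed
    finally show "expectation (\<lambda>\<omega>. b s \<omega> * J \<omega>) = expectation (\<lambda>\<omega>. b s \<omega> * ?w s \<omega>)"
      by (simp only: mult.commute)
  qed
  have Jq: "square_integrable \<Omega> J" by (rule ito_square_integrable(1)[OF J])
  have i': "integrable (time_product T) (case_prod (\<lambda>s \<omega>. b s \<omega> * J \<omega>))"
    using square_integrable_mult_integrable[OF b(1) square_integrable_const_in_time[OF Jq]]
    by (simp add: split_beta')
  have "expectation (\<lambda>\<omega>. running_integral T b T \<omega> * J \<omega>) =
      (\<integral>s. expectation (\<lambda>\<omega>. b s \<omega> * J \<omega>) \<partial>time_interval T)"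
    by (rule running_integral_inner(1)[OF b(1) Jq])
  also have "\<dots> = (\<integral>s. expectation (\<lambda>\<omega>. b s \<omega> * ?w s \<omega>) \<partial>time_interval T)"
    by (rule integral_cong_AE[OF _ _ bm])
       (intro borel_measurable_integrable P.integrable_fst[OF i] P.integrable_fst[OF i'])+
  also have "\<dots> = (\<integral>z. case_prod (\<lambda>s \<omega>. b s \<omega> * ?w s \<omega>) z \<partial>time_product T)"
    by (rule P.integral_fst[OF i])
  finally show ?thesis by (simp add: split_beta')
qed

text \<open>
Multiplying out the two decompositions leaves products of primitives, products of a primitive with
an Ito integral, and the product of the two Ito integrals; in the sum of their expectations the
primitives of \<open>b\<close> and \<open>c\<close> cancel.
\<close>

theorem expectation_product_ito_processes:
  assumes T: "0 \<le> T" and u: "ito_process T u0 b h u" and v: "ito_process T v0 c k v"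
  shows "expectation (\<lambda>\<omega>. u T \<omega> * v T \<omega>) = u0 * v0 +
    (\<integral>z. case_prod b z * case_prod v z + case_prod u z * case_prod c z + case_prod h z * case_prod k z
      \<partial>time_product T)"
proof -
  interpret PF: finite_measure "time_product T"
    by (intro finite_measure_pair_measure finite_time_interval finite_measure_axioms)
  have TT: "T \<in> {0..T}" using T by simp
  note bq = ito_processD(1)[OF u] and uq = ito_processD(2)[OF u] and bF = ito_processD(3)[OF u]
    and cq = ito_processD(1)[OF v] and vq = ito_processD(2)[OF v] and cF = ito_processD(3)[OF v]
  define A where "A = running_integral T b"
  define B where "B = running_integral T c"
  obtain I where I: "has_ito_integral h T I" "AE \<omega> in \<Omega>. u T \<omega> = u0 + A T \<omega> + I \<omega>"
    using ito_processD(4)[OF u TT] unfolding A_def by blast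
  obtain J where J: "has_ito_integral k T J" "AE \<omega> in \<Omega>. v T \<omega> = v0 + B T \<omega> + J \<omega>"
    using ito_processD(4)[OF v TT] unfolding B_def by blast
  note hq = ito_square_integrable(2)[OF I(1)] and kq = ito_square_integrable(2)[OF J(1)]
  note Iq = ito_square_integrable(1)[OF I(1)] and Jq = ito_square_integrable(1)[OF J(1)]
  note AT = square_integrable_running_integral(2)[OF bq TT, folded A_def]
    and BT = square_integrable_running_integral(2)[OF cq TT, folded B_def]
  note Aq = square_integrable_running_integral(1)[OF bq, folded A_def]
    and Bq = square_integrable_running_integral(1)[OF cq, folded B_def]
  note mm = square_integrable_mult_integrable and ii = square_integrable_integrable
  have eI: "expectation I = 0" by (rule ito_expectation_zero[OF I(1)])
  have eJ: "expectation J = 0" by (rule ito_expectation_zero[OF J(1)])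
  have eIJ: "expectation (\<lambda>\<omega>. I \<omega> * J \<omega>) = (\<integral>z. case_prod h z * case_prod k z \<partial>time_product T)"
    by (rule ito_isometry[OF I(1) J(1)])
  have eAJ: "expectation (\<lambda>\<omega>. A T \<omega> * J \<omega>) =
      (\<integral>z. case_prod b z * (case_prod v z - v0 - case_prod B z) \<partial>time_product T)"
    unfolding A_def B_def by (rule drift_times_ito_integral[OF bq bF v J(1)])
  have eBI: "expectation (\<lambda>\<omega>. B T \<omega> * I \<omega>) =
      (\<integral>z. case_prod c z * (case_prod u z - u0 - case_prod A z) \<partial>time_product T)"
    unfolding A_def B_def by (rule drift_times_ito_integral[OF cq cF u I(1)])
  have eAB: "expectation (\<lambda>\<omega>. A T \<omega> * B T \<omega>) =
      (\<integral>z. case_prod b z * case_prod B z + case_prod A z * case_prod c z \<partial>time_product T)"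
    unfolding A_def B_def by (rule running_integrals_inner[OF bq cq T])
  have eA: "expectation (A T) = (\<integral>z. case_prod b z \<partial>time_product T)"
    using running_integral_inner(2)[OF bq square_integrable_const[of 1]] by (simp add: A_def)
  have eB: "expectation (B T) = (\<integral>z. case_prod c z \<partial>time_product T)"
    using running_integral_inner(2)[OF cq square_integrable_const[of 1]] by (simp add: B_def)
  have "expectation (\<lambda>\<omega>. u T \<omega> * v T \<omega>) = expectation (\<lambda>\<omega>. (u0 + A T \<omega> + I \<omega>) * (v0 + B T \<omega> + J \<omega>))"
  proof (rule integral_cong_AE)
    show "AE \<omega> in \<Omega>. u T \<omega> * v T \<omega> = (u0 + A T \<omega> + I \<omega>) * (v0 + B T \<omega> + J \<omega>)"
      using I(2) J(2) by eventually_elim simp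
    show "(\<lambda>\<omega>. u T \<omega> * v T \<omega>) \<in> borel_measurable \<Omega>"
      by (intro borel_measurable_times square_integrable_sections(3)[OF uq TT]
          square_integrable_sections(3)[OF vq TT])
    show "(\<lambda>\<omega>. (u0 + A T \<omega> + I \<omega>) * (v0 + B T \<omega> + J \<omega>)) \<in> borel_measurable \<Omega>"
      by (intro borel_measurable_times borel_measurable_add borel_measurable_const
          square_integrable_measurable AT BT Iq Jq)
  qed
  also have "\<dots> = expectation (\<lambda>\<omega>. u0 * v0 + u0 * B T \<omega> + v0 * A T \<omega> + u0 * J \<omega> + v0 * I \<omega>
      + A T \<omega> * B T \<omega> + A T \<omega> * J \<omega> + B T \<omega> * I \<omega> + I \<omega> * J \<omega>)"
    by (simp add: algebra_simps)
  also have "\<dots> = u0 * v0 + u0 * expectation (B T) + v0 * expectation (A T) + u0 * expectation J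
      + v0 * expectation I + expectation (\<lambda>\<omega>. A T \<omega> * B T \<omega>) + expectation (\<lambda>\<omega>. A T \<omega> * J \<omega>)
      + expectation (\<lambda>\<omega>. B T \<omega> * I \<omega>) + expectation (\<lambda>\<omega>. I \<omega> * J \<omega>)"
    using ii[OF AT] ii[OF BT] ii[OF Iq] ii[OF Jq] mm[OF AT BT] mm[OF AT Jq] mm[OF BT Iq] mm[OF Iq Jq]
    by (simp add: prob_space)
  also have "\<dots> = u0 * v0 + u0 * (\<integral>z. case_prod c z \<partial>time_product T) + v0 * (\<integral>z. case_prod b z \<partial>time_product T)
      + u0 * 0 + v0 * 0
      + (\<integral>z. case_prod b z * case_prod B z + case_prod A z * case_prod c z \<partial>time_product T)
      + (\<integral>z. case_prod b z * (case_prod v z - v0 - case_prod B z) \<partial>time_product T)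
      + (\<integral>z. case_prod c z * (case_prod u z - u0 - case_prod A z) \<partial>time_product T)
      + (\<integral>z. case_prod h z * case_prod k z \<partial>time_product T)"
    unfolding eI eJ eIJ eAJ eBI eAB eA eB by simp
  also have "\<dots> = u0 * v0 + (\<integral>z. u0 * case_prod c z + v0 * case_prod b z
      + (case_prod b z * case_prod B z + case_prod A z * case_prod c z)
      + case_prod b z * (case_prod v z - v0 - case_prod B z)
      + case_prod c z * (case_prod u z - u0 - case_prod A z)
      + case_prod h z * case_prod k z \<partial>time_product T)"
    using PF.square_integrable_integrable[OF bq] PF.square_integrable_integrable[OF cq]
      mm[OF bq Bq] mm[OF Aq cq] mm[OF hq kq]
      mm[OF bq square_integrable_diff[OF square_integrable_diff[OF vq PF.square_integrable_const[of v0]] Bq]]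
      mm[OF cq square_integrable_diff[OF square_integrable_diff[OF uq PF.square_integrable_const[of u0]] Aq]]
    by simp
  also have "\<dots> = u0 * v0 +
    (\<integral>z. case_prod b z * case_prod v z + case_prod u z * case_prod c z + case_prod h z * case_prod k z
      \<partial>time_product T)"
    by (rule arg_cong[where f = "\<lambda>x. u0 * v0 + x"], rule Bochner_Integration.integral_cong)
       (auto simp: algebra_simps)
  finally show ?thesis .
qed

end


section \<open>Mixed moments of two solutions of a linear equation\<close>

lemma inner_vector_matrix: "y \<bullet> (x v* A) = (A *v y) \<bullet> x" for A :: "real^'n^'m"
  by (metis dot_lmul_matrix inner_commute)

text \<open>
The right-hand side is the drift of \<open>y \<bullet> X x\<close> along two solutions, so the generalized Lyapunov
operator generates their mixed second moments.
\<close>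

lemma inner_glyap:
  fixes M :: "real^'n^'n"
  shows "y \<bullet> (glyap M A\<^sub>1 X *v x) =
    (M *v y) \<bullet> (X *v x) + y \<bullet> (X *v (M *v x)) + (A\<^sub>1 *v y) \<bullet> (X *v (A\<^sub>1 *v x))"
  by (simp add: glyap_def matrix_vector_mult_add_rdistrib inner_add_right
      matrix_vector_mul_assoc[symmetric] inner_vector_matrix)

lemma inner_matrix_vector_sum:
  fixes X :: "real^'n^'m"
  shows "y \<bullet> (X *v x) = (\<Sum>i\<in>UNIV. \<Sum>j\<in>UNIV. X$i$j * (y$i * x$j))"
  by (simp add: inner_vec_def matrix_vector_mult_def sum_distrib_left mult_ac)

lemma bilinear_form_zero:
  fixes X :: "real^'n^'m"
  assumes "\<And>x y. y \<bullet> (X *v x) = 0"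
  shows "X = 0"
proof -
  have "X *v x = 0" for x using assms[of "X *v x" x] by simp
  thus ?thesis by (metis matrix_eq matrix_vector_mult_0)
qed

lemma square_integrable_matrix_component:
  fixes M :: "real^'n^'m"
  assumes "\<And>j. square_integrable N (\<lambda>z. f z $ j)"
  shows "square_integrable N (\<lambda>z. (M *v f z) $ i)"
  unfolding matrix_vector_mult_def
  by (simp, intro square_integrable_sum square_integrable_cmult assms)

context brownian_motion
begin

text \<open>
The vector-valued integrals in the definition of a solution are taken apart into components. For
the drift this requires its integrability along almost every path, which follows from the
square integrability of the solution.
\<close>

lemma solution_component:
  fixes x :: "real \<Rightarrow> 'w \<Rightarrow> real^'n"
  assumes sol: "solves_linear_sde M A\<^sub>1 x0 x" and T: "0 \<le> T"
  shows "ito_process T (x0 $ i) (\<lambda>s \<omega>. (M *v x s \<omega>) $ i) (\<lambda>s \<omega>. (A\<^sub>1 *v x s \<omega>) $ i) (\<lambda>s \<omega>. x s \<omega> $ i)"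
proof -
  have ad: "\<And>s. 0 \<le> s \<Longrightarrow> x s \<in> borel_measurable (F s)"
    and m: "case_prod x \<in> borel_measurable (time_product T)"
    and fin: "(\<integral>\<^sup>+(s, \<omega>). ennreal ((norm (x s \<omega>))\<^sup>2) \<partial>time_product T) < \<infinity>"
    and int: "\<And>s. 0 \<le> s \<Longrightarrow> \<exists>I. has_ito_integral (\<lambda>r \<omega>. A\<^sub>1 *v x r \<omega>) s I \<and>
        (AE \<omega> in \<Omega>. x s \<omega> = x0 + (LINT r:{0..s}|lborel. M *v x r \<omega>) + I \<omega>)"
    using sol T unfolding solves_linear_sde_def by blast+
  have nq: "square_integrable (time_product T) (case_prod (\<lambda>s \<omega>. norm (x s \<omega>)))"
    using fin measurable_compose[OF m borel_measurable_norm]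
    by (subst square_integrable_iff_nn_integral) (auto simp: split_beta')
  have xq: "square_integrable (time_product T) (\<lambda>z. case_prod x z $ j)" for j
  proof (rule square_integrable_bound[OF nq])
    show "(\<lambda>z. case_prod x z $ j) \<in> borel_measurable (time_product T)"
      using borel_measurable_inner[OF m borel_measurable_const[of "axis j 1"]] by (simp add: inner_axis)
    show "AE z in time_product T. \<bar>case_prod x z $ j\<bar> \<le> \<bar>case_prod (\<lambda>s \<omega>. norm (x s \<omega>)) z\<bar>"
      by (auto simp: component_le_norm_cart)
  qed
  have bq: "square_integrable (time_product T) (\<lambda>z. (M *v case_prod x z) $ i)"
    by (rule square_integrable_matrix_component[OF xq])
  have drift: "AE \<omega> in \<Omega>. \<forall>s\<in>{0..T}. (LINT r:{0..s}|lborel. M *v x r \<omega>) $ i =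
      running_integral T (\<lambda>s \<omega>. (M *v x s \<omega>) $ i) s \<omega>"
    using square_integrable_sections(1)[OF nq] AE_space
  proof eventually_elim
    fix \<omega> assume sq: "square_integrable (time_interval T) (\<lambda>s. norm (x s \<omega>))" and \<omega>: "\<omega> \<in> space \<Omega>"
    have "integrable (time_interval T) (\<lambda>s. norm (x s \<omega>))"
      using finite_measure.square_integrable_integrable[OF finite_time_interval sq] .
    moreover have "(\<lambda>s. x s \<omega>) \<in> borel_measurable (time_interval T)"
      using measurable_Pair1[OF m \<omega>] by simp
    ultimately have "integrable (time_interval T) (\<lambda>s. x s \<omega>)"
      using integrable_norm_iff by blast
    hence "integrable (time_interval T) (\<lambda>s. M *v x s \<omega>)"
      by (rule integrable_bounded_linear[OF matrix_vector_mul_bounded_linear])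
    hence si: "set_integrable lborel {0..T} (\<lambda>s. M *v x s \<omega>)"
      unfolding set_integrable_def by (subst (asm) integrable_restrict_space) auto
    show "\<forall>s\<in>{0..T}. (LINT r:{0..s}|lborel. M *v x r \<omega>) $ i =
      running_integral T (\<lambda>s \<omega>. (M *v x s \<omega>) $ i) s \<omega>"
    proof
      fix s assume s: "s \<in> {0..T}"
      have "set_integrable lborel {0..s} (\<lambda>s. M *v x s \<omega>)"
        by (rule set_integrable_subset[OF si]) (use s in auto)
      hence "(LINT r:{0..s}|lborel. M *v x r \<omega>) $ i =
          (\<integral>r. (indicator {0..s} r *\<^sub>R (M *v x r \<omega>)) $ i \<partial>lborel)"
        unfolding set_integrable_def set_lebesgue_integral_def
        by (rule integral_bounded_linear[OF bounded_linear_vec_nth, symmetric])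
      also have "\<dots> = (\<integral>r. indicator {0..T} r *\<^sub>R (indicator {..s} r * (M *v x r \<omega>) $ i) \<partial>lborel)"
        by (intro Bochner_Integration.integral_cong refl) (use s in \<open>auto simp: indicator_def\<close>)
      also have "\<dots> = running_integral T (\<lambda>s \<omega>. (M *v x s \<omega>) $ i) s \<omega>"
        unfolding running_integral_def by (rule integral_restrict_space[symmetric]) simp
      finally show "(LINT r:{0..s}|lborel. M *v x r \<omega>) $ i =
          running_integral T (\<lambda>s \<omega>. (M *v x s \<omega>) $ i) s \<omega>" .
    qed
  qed
  show ?thesis
    unfolding ito_process_def
  proof (intro conjI ballI)
    show "square_integrable (time_product T) (case_prod (\<lambda>s \<omega>. (M *v x s \<omega>) $ i))"
      using bq by (simp add: split_beta')
    show "square_integrable (time_product T) (case_prod (\<lambda>s \<omega>. x s \<omega> $ i))"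
      using xq by (simp add: split_beta')
  next
    fix s assume s: "s \<in> {0..T}"
    have "continuous_on UNIV (\<lambda>v. (M *v v) \<bullet> axis i 1)"
      by (intro continuous_on_inner continuous_on_const linear_continuous_on matrix_vector_mul_bounded_linear)
    hence "(\<lambda>\<omega>. (M *v x s \<omega>) \<bullet> axis i 1) \<in> borel_measurable (F s)"
      using measurable_compose[OF ad borel_measurable_continuous_onI, of s "\<lambda>v. (M *v v) \<bullet> axis i 1"] s
      by auto
    thus "(\<lambda>\<omega>. (M *v x s \<omega>) $ i) \<in> borel_measurable (F s)" by (simp add: inner_axis)
    obtain I where I: "has_ito_integral (\<lambda>r \<omega>. A\<^sub>1 *v x r \<omega>) s I"
      "AE \<omega> in \<Omega>. x s \<omega> = x0 + (LINT r:{0..s}|lborel. M *v x r \<omega>) + I \<omega>"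
      using int[of s] s by auto
    have "has_ito_integral (\<lambda>r \<omega>. (A\<^sub>1 *v x r \<omega>) \<bullet> axis i 1) s (\<lambda>\<omega>. I \<omega> \<bullet> axis i 1)"
      by (rule has_ito_integral_inner[OF I(1)]) simp
    moreover have "AE \<omega> in \<Omega>. x s \<omega> $ i =
        x0 $ i + running_integral T (\<lambda>s \<omega>. (M *v x s \<omega>) $ i) s \<omega> + I \<omega> $ i"
      using I(2) drift by eventually_elim (use s in auto)
    ultimately show "\<exists>I. has_ito_integral (\<lambda>s \<omega>. (A\<^sub>1 *v x s \<omega>) $ i) s I \<and>
        (AE \<omega> in \<Omega>. x s \<omega> $ i = x0 $ i + running_integral T (\<lambda>s \<omega>. (M *v x s \<omega>) $ i) s \<omega> + I \<omega>)"
      by (intro exI[of _ "\<lambda>\<omega>. I \<omega> $ i"]) (simp add: inner_axis)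
  qed
qed

lemma ito_process_square_integrable:
  assumes u: "ito_process T u0 b h u" and "0 \<le> T"
  shows "square_integrable \<Omega> (u T)"
proof -
  have T: "T \<in> {0..T}" using assms by simp
  obtain I where I: "has_ito_integral h T I"
    "AE \<omega> in \<Omega>. u T \<omega> = u0 + running_integral T b T \<omega> + I \<omega>"
    using ito_processD(4)[OF u T] by blast
  have "square_integrable \<Omega> (\<lambda>\<omega>. u0 + running_integral T b T \<omega> + I \<omega>)"
    by (intro square_integrable_add square_integrable_const
        square_integrable_running_integral(2)[OF ito_processD(1)[OF u] T] ito_square_integrable(1)[OF I(1)])
  moreover have "AE \<omega> in \<Omega>. \<bar>u T \<omega>\<bar> \<le> \<bar>u0 + running_integral T b T \<omega> + I \<omega>\<bar>"
    using I(2) by eventually_elim simp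
  ultimately show ?thesis
    using square_integrable_sections(3)[OF ito_processD(2)[OF u] T] square_integrable_bound by blast
qed

text \<open>
Dynkin's formula for the bilinear form of \<open>X\<close>: the product rule is applied to all pairs of
components and summed with the weights \<open>X\<^sub>i\<^sub>j\<close>.
\<close>

lemma expectation_bilinear_form:
  fixes x y :: "real \<Rightarrow> 'w \<Rightarrow> real^'n"
  assumes x: "solves_linear_sde M A\<^sub>1 x0 x" and y: "solves_linear_sde M A\<^sub>1 y0 y" and T: "0 \<le> T"
  shows "integrable \<Omega> (\<lambda>\<omega>. y T \<omega> \<bullet> (X *v x T \<omega>))"
    and "set_integrable lborel {0..T} (\<lambda>s. expectation (\<lambda>\<omega>. y s \<omega> \<bullet> (X *v x s \<omega>)))"
    and "expectation (\<lambda>\<omega>. y T \<omega> \<bullet> (X *v x T \<omega>)) = y0 \<bullet> (X *v x0) +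
      (LINT s:{0..T}|lborel. expectation (\<lambda>\<omega>. y s \<omega> \<bullet> (glyap M A\<^sub>1 X *v x s \<omega>)))"
proof -
  interpret P: pair_sigma_finite "time_interval T" \<Omega> by (rule pair_sigma_finite_time_product)
  note cx = solution_component[OF x T] and cy = solution_component[OF y T]
  note mm = square_integrable_mult_integrable
  have qx: "square_integrable (time_product T) (\<lambda>z. case_prod x z $ j)"
    and qy: "square_integrable (time_product T) (\<lambda>z. case_prod y z $ j)" for j
    using ito_processD(2)[OF cx[of j]] ito_processD(2)[OF cy[of j]] by (simp_all add: split_beta')
  have sx: "square_integrable \<Omega> (\<lambda>\<omega>. x T \<omega> $ j)" and sy: "square_integrable \<Omega> (\<lambda>\<omega>. y T \<omega> $ j)" for j
    using ito_process_square_integrable[OF cx[of j] T] ito_process_square_integrable[OF cy[of j] T] .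
  show int_T: "integrable \<Omega> (\<lambda>\<omega>. y T \<omega> \<bullet> (X *v x T \<omega>))" for X
    unfolding inner_matrix_vector_sum
    by (intro Bochner_Integration.integrable_sum integrable_mult_right mm[OF sy sx])
  have "integrable (time_product T) (\<lambda>z. case_prod y z \<bullet> (X *v case_prod x z))" for X
    unfolding inner_matrix_vector_sum
    by (intro Bochner_Integration.integrable_sum integrable_mult_right mm[OF qy qx])
  hence i: "integrable (time_product T) (case_prod (\<lambda>s \<omega>. y s \<omega> \<bullet> (X *v x s \<omega>)))" for X
    by (simp add: split_beta')
  show "set_integrable lborel {0..T} (\<lambda>s. expectation (\<lambda>\<omega>. y s \<omega> \<bullet> (X *v x s \<omega>)))" for X
    using P.integrable_fst[OF i[of X]]
    unfolding set_integrable_def by (subst (asm) integrable_restrict_space) auto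
  (* The integrand of the product rule for the components i of y and j of x. *)
  define \<Phi> where "\<Phi> i j z = (M *v case_prod y z) $ i * case_prod x z $ j
      + case_prod y z $ i * (M *v case_prod x z) $ j
      + (A\<^sub>1 *v case_prod y z) $ i * (A\<^sub>1 *v case_prod x z) $ j" for i j z
  note qq = qx qy square_integrable_matrix_component[OF qx] square_integrable_matrix_component[OF qy]
  have \<Phi>i: "integrable (time_product T) (\<Phi> i j)" for i j
    unfolding \<Phi>_def by (intro Bochner_Integration.integrable_add mm qq)
  have E: "expectation (\<lambda>\<omega>. y T \<omega> $ i * x T \<omega> $ j) = y0 $ i * x0 $ j + (\<integral>z. \<Phi> i j z \<partial>time_product T)" for i j
    using expectation_product_ito_processes[OF T cy[of i] cx[of j]] by (simp add: \<Phi>_def split_beta')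
  have sum\<Phi>: "(\<Sum>i\<in>UNIV. \<Sum>j\<in>UNIV. X$i$j * \<Phi> i j z) = case_prod y z \<bullet> (glyap M A\<^sub>1 X *v case_prod x z)" for z
    unfolding inner_glyap unfolding inner_matrix_vector_sum \<Phi>_def
    by (simp add: sum.distrib algebra_simps)
  have "expectation (\<lambda>\<omega>. y T \<omega> \<bullet> (X *v x T \<omega>)) =
      (\<Sum>i\<in>UNIV. \<Sum>j\<in>UNIV. X$i$j * expectation (\<lambda>\<omega>. y T \<omega> $ i * x T \<omega> $ j))"
    unfolding inner_matrix_vector_sum
    by (simp add: Bochner_Integration.integral_sum Bochner_Integration.integrable_sum mm[OF sy sx])
  also have "\<dots> = y0 \<bullet> (X *v x0) + (\<Sum>i\<in>UNIV. \<Sum>j\<in>UNIV. X$i$j * (\<integral>z. \<Phi> i j z \<partial>time_product T))"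
    unfolding E by (simp add: inner_matrix_vector_sum sum.distrib distrib_left)
  also have "(\<Sum>i\<in>UNIV. \<Sum>j\<in>UNIV. X$i$j * (\<integral>z. \<Phi> i j z \<partial>time_product T)) =
      (\<integral>z. (\<Sum>i\<in>UNIV. \<Sum>j\<in>UNIV. X$i$j * \<Phi> i j z) \<partial>time_product T)"
    by (simp add: Bochner_Integration.integral_sum Bochner_Integration.integrable_sum \<Phi>i)
  also have "\<dots> = (\<integral>s. expectation (\<lambda>\<omega>. y s \<omega> \<bullet> (glyap M A\<^sub>1 X *v x s \<omega>)) \<partial>time_interval T)"
    unfolding sum\<Phi> using P.integral_fst[OF i[of "glyap M A\<^sub>1 X"]] by (simp add: split_beta')
  also have "\<dots> = (LINT s:{0..T}|lborel. expectation (\<lambda>\<omega>. y s \<omega> \<bullet> (glyap M A\<^sub>1 X *v x s \<omega>)))"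
    unfolding set_lebesgue_integral_def by (rule integral_restrict_space) simp
  finally show "expectation (\<lambda>\<omega>. y T \<omega> \<bullet> (X *v x T \<omega>)) = y0 \<bullet> (X *v x0) +
      (LINT s:{0..T}|lborel. expectation (\<lambda>\<omega>. y s \<omega> \<bullet> (glyap M A\<^sub>1 X *v x s \<omega>)))" .
qed

definition bilinear_moment ::
  "(real \<Rightarrow> 'w \<Rightarrow> real^'n) \<Rightarrow> (real \<Rightarrow> 'w \<Rightarrow> real^'n) \<Rightarrow> real^'n^'n \<Rightarrow> real \<Rightarrow> real" where
  "bilinear_moment y x X t = expectation (\<lambda>\<omega>. y t \<omega> \<bullet> (X *v x t \<omega>))"

text \<open>
The integral equation holds for every matrix. It makes all these moments continuous, including
the one in its own integrand, and then the integral may be differentiated.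
\<close>

lemma bilinear_moment_derivative:
  fixes x y :: "real \<Rightarrow> 'w \<Rightarrow> real^'n"
  assumes x: "solves_linear_sde M A\<^sub>1 x0 x" and y: "solves_linear_sde M A\<^sub>1 y0 y"
  shows "bilinear_moment y x X 0 = y0 \<bullet> (X *v x0)"
    and "t \<in> {0..T} \<Longrightarrow>
      (bilinear_moment y x X has_vector_derivative bilinear_moment y x (glyap M A\<^sub>1 X) t) (at t within {0..T})"
proof -
  let ?\<phi> = "bilinear_moment y x"
  note D = expectation_bilinear_form[OF x y, folded bilinear_moment_def]
  have int: "?\<phi> X integrable_on {0..t}" if "0 \<le> t" for X t
    using set_borel_integral_eq_integral(1)[OF D(2)[OF that]] .
  have eq: "?\<phi> X t = y0 \<bullet> (X *v x0) + integral {0..t} (?\<phi> (glyap M A\<^sub>1 X))" if "0 \<le> t" for X t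
    using D(3)[OF that, of X] set_borel_integral_eq_integral(2)[OF D(2)[OF that, of "glyap M A\<^sub>1 X"]]
    by simp
  show "?\<phi> X 0 = y0 \<bullet> (X *v x0)" using eq[of 0 X] by simp
  have cont: "continuous_on {0..T} (?\<phi> X)" if "0 \<le> T" for X T
  proof -
    have "continuous_on {0..T} (\<lambda>t. y0 \<bullet> (X *v x0) + integral {0..t} (?\<phi> (glyap M A\<^sub>1 X)))"
      by (intro continuous_intros indefinite_integral_continuous_1 int that)
    thus ?thesis by (rule continuous_on_eq) (simp add: eq)
  qed
  assume t: "t \<in> {0..T}"
  hence T: "0 \<le> T" by simp
  have "((\<lambda>t. y0 \<bullet> (X *v x0) + integral {0..t} (?\<phi> (glyap M A\<^sub>1 X))) has_vector_derivative
      0 + ?\<phi> (glyap M A\<^sub>1 X) t) (at t within {0..T})"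
    by (intro has_vector_derivative_add has_vector_derivative_const
        integral_has_vector_derivative[OF cont[OF T] t])
  hence "((\<lambda>t. y0 \<bullet> (X *v x0) + integral {0..t} (?\<phi> (glyap M A\<^sub>1 X))) has_vector_derivative
      ?\<phi> (glyap M A\<^sub>1 X) t) (at t within {0..T})" by simp
  thus "(?\<phi> X has_vector_derivative ?\<phi> (glyap M A\<^sub>1 X) t) (at t within {0..T})"
    by (rule has_vector_derivative_transform[OF t, rotated]) (auto simp: eq)
qed

lemma bilinear_moment_tendsto_zero:
  fixes x y :: "real \<Rightarrow> 'w \<Rightarrow> real^'n"
  assumes x: "solves_linear_sde M A\<^sub>1 x0 x" and y: "solves_linear_sde M A\<^sub>1 y0 y"
    and x0: "((\<lambda>t. \<integral>\<^sup>+\<omega>. ennreal ((norm (x t \<omega>))\<^sup>2) \<partial>\<Omega>) \<longlongrightarrow> 0) at_top"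
    and y0: "((\<lambda>t. \<integral>\<^sup>+\<omega>. ennreal ((norm (y t \<omega>))\<^sup>2) \<partial>\<Omega>) \<longlongrightarrow> 0) at_top"
  shows "(bilinear_moment y x X \<longlongrightarrow> 0) at_top"
proof -
  let ?\<phi> = "\<lambda>t. expectation (\<lambda>\<omega>. y t \<omega> \<bullet> (X *v x t \<omega>))"
  let ?S = "\<lambda>z t. \<integral>\<^sup>+\<omega>. ennreal ((norm (z t \<omega> :: real^'n))\<^sup>2) \<partial>\<Omega>"
  obtain K where K: "K > 0" "\<And>v. norm (X *v v) \<le> norm v * K"
    using bounded_linear.pos_bounded[OF matrix_vector_mul_bounded_linear[of X]] by blast
  have bound: "\<bar>v \<bullet> (X *v w)\<bar> \<le> K * ((norm v)\<^sup>2 + (norm w)\<^sup>2)" for v w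
  proof -
    have "\<bar>v \<bullet> (X *v w)\<bar> \<le> norm v * norm (X *v w)" by (rule Cauchy_Schwarz_ineq2)
    also have "\<dots> \<le> norm v * (norm w * K)" by (intro mult_left_mono K) simp
    also have "\<dots> = K * (norm v * norm w)" by simp
    also have "\<dots> \<le> K * ((norm v)\<^sup>2 + (norm w)\<^sup>2)"
    proof (rule mult_left_mono)
      have "0 \<le> (norm v - norm w)\<^sup>2" by simp
      moreover have "0 \<le> norm v * norm w" by simp
      ultimately show "norm v * norm w \<le> (norm v)\<^sup>2 + (norm w)\<^sup>2"
        unfolding power2_diff by linarith
    qed (use K in simp)
    finally show ?thesis .
  qed
  have le: "ennreal \<bar>?\<phi> t\<bar> \<le> ennreal K * (?S y t + ?S x t)" if t: "0 \<le> t" for t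
  proof -
    have "x t \<in> borel_measurable (F t)" "y t \<in> borel_measurable (F t)"
      using x y t unfolding solves_linear_sde_def by blast+
    hence [measurable]: "x t \<in> borel_measurable \<Omega>" "y t \<in> borel_measurable \<Omega>"
      using borel_measurable_F t by blast+
    have "ennreal \<bar>?\<phi> t\<bar> \<le> (\<integral>\<^sup>+\<omega>. norm (y t \<omega> \<bullet> (X *v x t \<omega>)) \<partial>\<Omega>)"
      using integral_norm_bound_ennreal[OF expectation_bilinear_form(1)[OF x y t, of X]] by simp
    also have "\<dots> \<le> (\<integral>\<^sup>+\<omega>. ennreal K * (ennreal ((norm (y t \<omega>))\<^sup>2) + ennreal ((norm (x t \<omega>))\<^sup>2)) \<partial>\<Omega>)"
      using K(1) bound by (intro nn_integral_mono)
        (simp add: ennreal_plus[symmetric] ennreal_mult'[symmetric] del: ennreal_plus)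
    also have "\<dots> = ennreal K * (?S y t + ?S x t)"
      by (subst nn_integral_cmult) (auto simp: nn_integral_add)
    finally show ?thesis .
  qed
  have "((\<lambda>t. ennreal K * (?S y t + ?S x t)) \<longlongrightarrow> ennreal K * (0 + 0)) at_top"
    by (intro ennreal_tendsto_cmult tendsto_add x0 y0) simp
  hence lim: "((\<lambda>t. ennreal K * (?S y t + ?S x t)) \<longlongrightarrow> 0) at_top" by simp
  have "((\<lambda>t. ennreal \<bar>?\<phi> t\<bar>) \<longlongrightarrow> ennreal 0) at_top"
    unfolding ennreal_0
    by (rule tendsto_sandwich[OF _ _ tendsto_const lim])
       (use le in \<open>auto simp: eventually_at_top_linorder\<close>)
  hence "((\<lambda>t. \<bar>?\<phi> t\<bar>) \<longlongrightarrow> 0) at_top"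
    by (subst (asm) tendsto_ennreal_iff) auto
  thus ?thesis by (simp add: tendsto_rabs_zero_iff bilinear_moment_def[abs_def])
qed

text \<open>
\<open>X\<close> and \<open>Y\<close> are the real and imaginary parts of a complex eigenvector with eigenvalue \<open>\<mu>\<close>. The
complex moment that belongs to it is multiplied by \<open>exp (t \<mu>)\<close> in time \<open>t\<close>, hence
does not decrease in modulus, and yet tends to zero.
\<close>

lemma stable_imp_no_unstable_eigenvector:
  fixes M A\<^sub>1 :: "real^'n^'n"
  assumes stable: "asymp_mean_square_stable M A\<^sub>1"
    and X: "glyap M A\<^sub>1 X = Re \<mu> *\<^sub>R X - Im \<mu> *\<^sub>R Y" and Y: "glyap M A\<^sub>1 Y = Im \<mu> *\<^sub>R X + Re \<mu> *\<^sub>R Y"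
    and \<mu>: "0 \<le> Re \<mu>"
  shows "X = 0 \<and> Y = 0"
proof -
  have "y0 \<bullet> (X *v x0) = 0 \<and> y0 \<bullet> (Y *v x0) = 0" for x0 y0
  proof -
    obtain x where x: "solves_linear_sde M A\<^sub>1 x0 x"
        "((\<lambda>t. \<integral>\<^sup>+\<omega>. ennreal ((norm (x t \<omega>))\<^sup>2) \<partial>\<Omega>) \<longlongrightarrow> 0) at_top"
      using stable unfolding asymp_mean_square_stable_def by blast
    obtain y where y: "solves_linear_sde M A\<^sub>1 y0 y"
        "((\<lambda>t. \<integral>\<^sup>+\<omega>. ennreal ((norm (y t \<omega>))\<^sup>2) \<partial>\<Omega>) \<longlongrightarrow> 0) at_top"
      using stable unfolding asymp_mean_square_stable_def by blast
    let ?\<phi> = "bilinear_moment y x"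
    note D = bilinear_moment_derivative[OF x(1) y(1)]
    have lin: "?\<phi> (a *\<^sub>R X + b *\<^sub>R Y) t = a * ?\<phi> X t + b * ?\<phi> Y t" if "0 \<le> t" for a b t
      using expectation_bilinear_form(1)[OF x(1) y(1) that]
      by (simp add: bilinear_moment_def matrix_vector_mult_add_rdistrib scaleR_matrix_vector_assoc[symmetric]
          inner_add_right)
    define f where "f t = complex_of_real (?\<phi> X t) + \<i> * complex_of_real (?\<phi> Y t)" for t
    have f_growth: "f T = exp (T *\<^sub>R \<mu>) * f 0" if T: "0 \<le> T" for T
    proof -
      have "((\<lambda>t. exp (t *\<^sub>R (- \<mu>)) * f t) has_vector_derivative 0) (at t within {0..T})"
        if t: "t \<in> {0..T}" for t
      proof -
        have "(f has_vector_derivative (of_real (?\<phi> (glyap M A\<^sub>1 X) t) + \<i> * of_real (?\<phi> (glyap M A\<^sub>1 Y) t)))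
            (at t within {0..T})"
          unfolding f_def
          by (intro has_vector_derivative_add has_vector_derivative_of_real has_vector_derivative_mult_right
              D(2)[OF t, folded has_real_derivative_iff_has_vector_derivative])
        also have "of_real (?\<phi> (glyap M A\<^sub>1 X) t) + \<i> * of_real (?\<phi> (glyap M A\<^sub>1 Y) t) = \<mu> * f t"
          using lin[of t "Re \<mu>" "- Im \<mu>"] lin[of t "Im \<mu>" "Re \<mu>"] t
          by (simp add: X Y f_def complex_eq_iff algebra_simps)
        finally have "((\<lambda>t. exp (t *\<^sub>R (- \<mu>)) * f t) has_vector_derivative
            (exp (t *\<^sub>R (- \<mu>)) * (\<mu> * f t) + (exp (t *\<^sub>R (- \<mu>)) * (- \<mu>)) * f t)) (at t within {0..T})"
          by (intro has_vector_derivative_mult exp_scaleR_has_vector_derivative_right)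
        thus ?thesis by (simp add: algebra_simps)
      qed
      hence "\<exists>c. \<forall>t\<in>{0..T}. exp (t *\<^sub>R (- \<mu>)) * f t = c"
        by (intro has_derivative_zero_constant) (auto simp: has_vector_derivative_def)
      hence "exp (T *\<^sub>R (- \<mu>)) * f T = exp (0 *\<^sub>R (- \<mu>)) * f 0" using T by force
      hence "exp (T *\<^sub>R \<mu>) * (exp (T *\<^sub>R (- \<mu>)) * f T) = exp (T *\<^sub>R \<mu>) * f 0" by simp
      thus ?thesis by (simp add: mult.assoc[symmetric] exp_add[symmetric])
    qed
    have "((\<lambda>t. of_real (?\<phi> X t) + \<i> * of_real (?\<phi> Y t)) \<longlongrightarrow> of_real 0 + \<i> * of_real 0) at_top"
      by (intro tendsto_intros bilinear_moment_tendsto_zero[OF x(1) y(1) x(2) y(2)])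
    hence lim: "((\<lambda>t. norm (f t)) \<longlongrightarrow> 0) at_top" by (simp add: f_def tendsto_norm_zero_iff)
    have "norm (f 0) \<le> norm (f t)" if "0 \<le> t" for t
    proof -
      have "1 * norm (f 0) \<le> exp (t * Re \<mu>) * norm (f 0)"
        using that \<mu> by (intro mult_right_mono) auto
      thus ?thesis using f_growth[OF that] by (simp add: norm_mult)
    qed
    hence "norm (f 0) \<le> 0"
      by (intro tendsto_lowerbound[OF lim]) (auto simp: eventually_at_top_linorder)
    hence "f 0 = 0" by simp
    thus ?thesis using D(1) by (simp add: f_def complex_eq_iff)
  qed
  thus ?thesis using bilinear_form_zero by blast
qed

end


section \<open>Lower bounds for the generalized Lyapunov operator\<close>

lemma bounded_bilinear_matrix_mult:
  "bounded_bilinear ((**) :: 'a::{euclidean_space, real_algebra_1}^'m^'n \<Rightarrow> 'a^'p^'m \<Rightarrow> 'a^'p^'n)"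
proof -
  have "bilinear ((**) :: 'a^'m^'n \<Rightarrow> 'a^'p^'m \<Rightarrow> 'a^'p^'n)"
    unfolding bilinear_def
    by (auto intro!: linearI simp: matrix_matrix_mult_def
        vec_eq_iff scaleR_sum_right sum.distrib distrib_left distrib_right)
  thus ?thesis by (simp add: bilinear_conv_bounded_bilinear)
qed

lemma bounded_linear_transpose: "bounded_linear (transpose :: 'a::euclidean_space^'m^'n \<Rightarrow> 'a^'n^'m)"
  by (intro linear_conv_bounded_linear[THEN iffD1] linearI) (auto simp: transpose_def vec_eq_iff)

abbreviation complexify :: "real^'m^'n \<Rightarrow> complex^'m^'n" where
  "complexify \<equiv> map_matrix complex_of_real"

lemma complexify_mult: "complexify (A ** B) = complexify A ** complexify B"
  by (simp add: vec_eq_iff matrix_matrix_mult_def)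

lemma complexify_add: "complexify (A + B) = complexify A + complexify B"
  by (simp add: vec_eq_iff)

lemma complexify_diff: "complexify (A - B) = complexify A - complexify B"
  by (simp add: vec_eq_iff)

lemma complexify_transpose: "complexify (transpose A) = transpose (complexify A)"
  by (simp add: vec_eq_iff transpose_def)

lemma norm_complexify: "norm (complexify A) = norm A"
  by (simp add: norm_vec_def map_matrix_def)

lemma complexify_glyap: "complexify (glyap M A\<^sub>1 X) = glyap (complexify M) (complexify A\<^sub>1) (complexify X)"
  by (simp add: glyap_def complexify_add complexify_mult complexify_transpose)

lemma map_matrix_Re_mult:
  "map_matrix Re (complexify A ** X) = A ** map_matrix Re X"
  "map_matrix Re (X ** complexify B) = map_matrix Re X ** B"
  "map_matrix Im (complexify A ** X) = A ** map_matrix Im X"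
  "map_matrix Im (X ** complexify B) = map_matrix Im X ** B"
  by (simp_all add: vec_eq_iff matrix_matrix_mult_def)

lemma map_matrix_Re_add:
  "map_matrix Re (X + Y) = map_matrix Re X + map_matrix Re Y"
  "map_matrix Im (X + Y) = map_matrix Im X + map_matrix Im Y"
  by (simp_all add: vec_eq_iff)

lemma glyap_Re_Im:
  "map_matrix Re (glyap (complexify M) (complexify A\<^sub>1) X) = glyap M A\<^sub>1 (map_matrix Re X)"
  "map_matrix Im (glyap (complexify M) (complexify A\<^sub>1) X) = glyap M A\<^sub>1 (map_matrix Im X)"
  unfolding glyap_def map_matrix_Re_add map_matrix_Re_mult complexify_transpose[symmetric] by simp_all

text \<open>
For \<open>m > 0\<close>, the resolvent of the complexified operator exists and has norm at most \<open>1 / m\<close> on the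
closed right half plane.
\<close>

definition resolvent_bound :: "real^'n^'n \<Rightarrow> real^'n^'n \<Rightarrow> real \<Rightarrow> bool" where
  "resolvent_bound M A\<^sub>1 m \<longleftrightarrow>
     (\<forall>\<mu> X. 0 \<le> Re \<mu> \<longrightarrow>
        m * norm X \<le> norm (glyap (complexify M) (complexify A\<^sub>1) X - map_matrix ((*) \<mu>) X))"

lemma norm_map_matrix_mult: "norm (map_matrix ((*) \<mu>) X) = norm \<mu> * norm (X :: complex^'n^'m)"
proof -
  have "L2_set (\<lambda>j. norm \<mu> * norm (X $ i $ j)) UNIV = norm \<mu> * L2_set (\<lambda>j. norm (X $ i $ j)) UNIV" for i
    by (rule L2_set_right_distrib[symmetric]) simp
  thus ?thesis
    by (simp add: norm_vec_def map_matrix_def norm_mult L2_set_right_distrib)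
qed

lemma glyap_bounded_linear: "bounded_linear (glyap (M :: complex^'n^'n) A\<^sub>1)"
proof -
  interpret mm: bounded_bilinear "(**) :: complex^'n^'n \<Rightarrow> _ \<Rightarrow> complex^'n^'n"
    by (rule bounded_bilinear_matrix_mult)
  show ?thesis
    unfolding glyap_def
    by (intro bounded_linear_add mm.bounded_linear_left mm.bounded_linear_right
        bounded_linear_compose[OF mm.bounded_linear_left mm.bounded_linear_right])
qed

text \<open>
Outside a large disc \<open>\<mu> X\<close> dominates the bounded operator. Inside the disc the pairs of \<open>\<mu>\<close> and a unit
vector \<open>X\<close> form a compact set on which the norm is positive by injectivity.
\<close>

lemma resolvent_bound_exists:
  fixes M A\<^sub>1 :: "real^'n^'n"
  assumes inj: "\<And>\<mu> X. 0 \<le> Re \<mu> \<Longrightarrow> glyap (complexify M) (complexify A\<^sub>1) X = map_matrix ((*) \<mu>) X \<Longrightarrow> X = 0"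
  shows "\<exists>m>0. resolvent_bound M A\<^sub>1 m"
proof -
  let ?L = "glyap (complexify M) (complexify A\<^sub>1)"
  obtain K where K: "K > 0" "\<And>X. norm (?L X) \<le> norm X * K"
    using bounded_linear.pos_bounded[OF glyap_bounded_linear] by blast
  (* Beyond radius K + 1 the triangle inequality gives the constant 1. *)
  define S where "S = ({\<mu>. 0 \<le> Re \<mu>} \<inter> cball 0 (K + 1)) \<times> (sphere 0 1 :: (complex^'n^'n) set)"
  define g where "g = (\<lambda>(\<mu>, X). norm (?L X - map_matrix ((*) \<mu>) X))"
  have "compact S"
    unfolding S_def
    by (intro compact_Times closed_Int_compact closed_halfspace_Re_ge) auto
  moreover have "S \<noteq> {}"
  proof -
    obtain u :: "complex^'n^'n" where "norm u = 1" using vector_choose_size[of 1] by auto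
    hence "(0, u) \<in> S" using K by (auto simp: S_def)
    thus ?thesis by blast
  qed
  moreover have "continuous_on S g"
  proof -
    have "continuous_on S (\<lambda>z. map_matrix ((*) (fst z)) (snd z))"
      unfolding map_matrix_def by (intro continuous_intros continuous_on_vec_lambda)
    moreover have "continuous_on S (\<lambda>z. ?L (snd z))"
      by (rule bounded_linear.continuous_on[OF glyap_bounded_linear]) (intro continuous_intros)
    ultimately show ?thesis unfolding g_def split_beta' by (intro continuous_intros)
  qed
  ultimately obtain z where z: "z \<in> S" "\<And>w. w \<in> S \<Longrightarrow> g z \<le> g w"
    using continuous_attains_inf[of S g] by blast
  have gz: "0 < g z"
  proof -
    obtain \<mu> X where zz: "z = (\<mu>, X)" by (cases z)
    hence "0 \<le> Re \<mu>" "X \<noteq> 0" using z(1) by (auto simp: S_def)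
    thus ?thesis using inj[of \<mu> X] by (auto simp: g_def zz)
  qed
  define m where "m = min 1 (g z)"
  have "m * norm X \<le> norm (?L X - map_matrix ((*) \<mu>) X)" if \<mu>: "0 \<le> Re \<mu>" for \<mu> X
  proof (cases "norm \<mu> \<le> K + 1")
    case False
    have "m * norm X \<le> 1 * norm X" by (intro mult_right_mono) (auto simp: m_def)
    also have "\<dots> \<le> (norm \<mu> - K) * norm X" using False by (intro mult_right_mono) auto
    also have "\<dots> \<le> norm (map_matrix ((*) \<mu>) X) - norm (?L X)"
      using K(2)[of X] by (simp add: norm_map_matrix_mult algebra_simps)
    also have "\<dots> \<le> norm (?L X - map_matrix ((*) \<mu>) X)"
      using norm_triangle_ineq2[of "map_matrix ((*) \<mu>) X" "?L X"] by (simp add: norm_minus_commute)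
    finally show ?thesis .
  next
    case True
    show ?thesis
    proof (cases "X = 0")
      case False
      define U where "U = (1 / norm X) *\<^sub>R X"
      have X: "X = norm X *\<^sub>R U" and U: "norm U = 1" using False by (auto simp: U_def)
      have "(\<mu>, U) \<in> S" using \<mu> True U by (auto simp: S_def)
      hence "m \<le> norm (?L U - map_matrix ((*) \<mu>) U)" using z(2) by (force simp: m_def g_def)
      hence "m * norm X \<le> norm (?L U - map_matrix ((*) \<mu>) U) * norm X" by (rule mult_right_mono) simp
      also have "\<dots> = norm (norm X *\<^sub>R (?L U - map_matrix ((*) \<mu>) U))" by simp
      also have "norm X *\<^sub>R (?L U - map_matrix ((*) \<mu>) U) = ?L (norm X *\<^sub>R U) - map_matrix ((*) \<mu>) (norm X *\<^sub>R U)"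
      proof -
        have "map_matrix ((*) \<mu>) (norm X *\<^sub>R U) = norm X *\<^sub>R map_matrix ((*) \<mu>) U"
          by (simp add: vec_eq_iff)
        thus ?thesis by (simp only: linear_scale[OF bounded_linear.linear[OF glyap_bounded_linear]] scaleR_diff_right)
      qed
      finally show ?thesis using X by simp
    qed simp
  qed
  moreover have "m > 0" using gz by (simp add: m_def)
  ultimately show ?thesis unfolding resolvent_bound_def by blast
qed

text \<open>
The dependence on \<open>M\<close> is affine: replacing \<open>M\<close> by \<open>M + \<Delta>\<close> adds \<open>X \<Delta> + \<Delta>\<^sup>T X\<close>, independently
of \<open>\<mu>\<close>.
\<close>

lemma resolvent_bound_perturb:
  fixes M A\<^sub>1 :: "real^'n^'n"
  assumes bnd: "resolvent_bound M A\<^sub>1 m" and m: "m > 0"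
  shows "\<exists>\<eta>>0. \<forall>M'. norm (M' - M) \<le> \<eta> \<longrightarrow> resolvent_bound M' A\<^sub>1 (m / 2)"
proof -
  interpret mm: bounded_bilinear "(**) :: complex^'n^'n \<Rightarrow> _ \<Rightarrow> complex^'n^'n"
    by (rule bounded_bilinear_matrix_mult)
  obtain K where K: "K > 0" "\<And>(A :: complex^'n^'n) (B :: complex^'n^'n). norm (A ** B) \<le> norm A * norm B * K"
    using mm.pos_bounded by blast
  obtain Kt where Kt: "Kt > 0" "\<And>A :: complex^'n^'n. norm (transpose A) \<le> norm A * Kt"
  proof -
    have "bounded_linear (transpose :: complex^'n^'n \<Rightarrow> complex^'n^'n)"
      by (rule bounded_linear_transpose)
    thus ?thesis using that by (meson bounded_linear.pos_bounded)
  qed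
  define c where "c = K * (1 + Kt)"
  define \<eta> where "\<eta> = m / (2 * c)"
  have c: "c > 0" using K(1) Kt(1) by (simp add: c_def)
  hence "\<eta> > 0" using m by (simp add: \<eta>_def)
  moreover have "resolvent_bound M' A\<^sub>1 (m / 2)" if M': "norm (M' - M) \<le> \<eta>" for M'
    unfolding resolvent_bound_def
  proof (intro allI impI)
    fix \<mu> and X :: "complex^'n^'n" assume \<mu>: "0 \<le> Re \<mu>"
    define \<Delta> where "\<Delta> = complexify (M' - M)"
    have n\<Delta>: "norm \<Delta> \<le> \<eta>" using M' by (simp add: \<Delta>_def norm_complexify)
    have "complexify M' = complexify M + \<Delta>" by (simp add: \<Delta>_def complexify_diff)
    hence split: "glyap (complexify M') (complexify A\<^sub>1) X =
        glyap (complexify M) (complexify A\<^sub>1) X + (X ** \<Delta> + transpose \<Delta> ** X)"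
      by (simp only: glyap_def mm.add_left mm.add_right add_ac linear_add[OF bounded_linear.linear[OF bounded_linear_transpose]])
    have "norm (X ** \<Delta> + transpose \<Delta> ** X) \<le> norm X * norm \<Delta> * K + norm \<Delta> * Kt * norm X * K"
    proof (rule order_trans[OF norm_triangle_ineq add_mono])
      show "norm (X ** \<Delta>) \<le> norm X * norm \<Delta> * K" by (rule K)
      have "norm (transpose \<Delta> ** X) \<le> norm (transpose \<Delta>) * norm X * K" by (rule K)
      also have "\<dots> \<le> norm \<Delta> * Kt * norm X * K"
        by (rule mult_right_mono[OF mult_right_mono[OF Kt(2)]]) (use K(1) in auto)
      finally show "norm (transpose \<Delta> ** X) \<le> norm \<Delta> * Kt * norm X * K" .
    qed
    also have "\<dots> = norm \<Delta> * c * norm X" unfolding c_def by algebra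
    also have "\<dots> \<le> \<eta> * c * norm X"
      by (rule mult_right_mono[OF mult_right_mono[OF n\<Delta>]]) (use c in auto)
    also have "\<eta> * c = m / 2" using c unfolding \<eta>_def by simp
    finally have "norm (X ** \<Delta> + transpose \<Delta> ** X) \<le> m / 2 * norm X" .
    moreover have "m * norm X \<le> norm (glyap (complexify M) (complexify A\<^sub>1) X - map_matrix ((*) \<mu>) X)"
      using bnd \<mu> by (simp add: resolvent_bound_def)
    moreover have "norm (glyap (complexify M) (complexify A\<^sub>1) X - map_matrix ((*) \<mu>) X) \<le>
       norm (glyap (complexify M') (complexify A\<^sub>1) X - map_matrix ((*) \<mu>) X) + norm (X ** \<Delta> + transpose \<Delta> ** X)"
    proof -
      let ?P = "glyap (complexify M) (complexify A\<^sub>1) X" and ?Q = "map_matrix ((*) \<mu>) X"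
        and ?N = "X ** \<Delta> + transpose \<Delta> ** X"
      have "?P - ?Q = (?P + ?N - ?Q) - ?N" by (simp only: algebra_simps)
      thus ?thesis unfolding split by (metis norm_triangle_ineq4)
    qed
    ultimately show "m / 2 * norm X \<le> norm (glyap (complexify M') (complexify A\<^sub>1) X - map_matrix ((*) \<mu>) X)"
      by simp
  qed
  ultimately show ?thesis by blast
qed

lemma resolvent_bound_spectrum:
  assumes "resolvent_bound M A\<^sub>1 m" "m > 0"
  shows "glyap_spectrum M A\<^sub>1 \<subseteq> open_left_half_plane"
proof
  fix \<mu> assume "\<mu> \<in> glyap_spectrum M A\<^sub>1"
  then obtain X where X: "X \<noteq> 0" "glyap (complexify M) (complexify A\<^sub>1) X = map_matrix ((*) \<mu>) X"
    unfolding glyap_spectrum_def by auto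
  have "\<not> 0 \<le> Re \<mu>"
  proof
    assume "0 \<le> Re \<mu>"
    hence "m * norm X \<le> norm (glyap (complexify M) (complexify A\<^sub>1) X - map_matrix ((*) \<mu>) X)"
      using assms(1) unfolding resolvent_bound_def by blast
    hence "m * norm X \<le> 0" unfolding X(2) by simp
    thus False using X(1) assms(2) by (simp add: mult_le_0_iff)
  qed
  thus "\<mu> \<in> open_left_half_plane" by (simp add: open_left_half_plane_def)
qed

lemma resolvent_bound_glyap:
  fixes X :: "real^'n^'n"
  assumes "resolvent_bound M A\<^sub>1 m"
  shows "m * norm X \<le> norm (glyap M A\<^sub>1 X)"
proof -
  have "m * norm (complexify X) \<le> norm (complexify (glyap M A\<^sub>1 X) - map_matrix ((*) 0) (complexify X))"
    using assms unfolding resolvent_bound_def complexify_glyap by simp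
  moreover have "map_matrix ((*) 0) (complexify X) = 0" by (simp add: vec_eq_iff)
  ultimately show ?thesis by (simp add: norm_complexify)
qed

lemma symmetric_matrix_inv:
  fixes R :: "real^'m^'m"
  assumes R: "invertible R" "transpose R = R"
  shows "transpose (matrix_inv R) = matrix_inv R"
proof -
  let ?N = "matrix_inv R"
  have inv: "R ** ?N = mat 1"
    using someI_ex[OF R(1)[unfolded invertible_def]] unfolding matrix_inv_def by blast
  have "transpose ?N ** R = transpose (R ** ?N)" using R(2) by (simp add: matrix_transpose_mul)
  also have "\<dots> = mat 1" by (simp add: inv transpose_mat)
  finally have "(transpose ?N ** R) ** ?N = ?N" by simp
  moreover have "(transpose ?N ** R) ** ?N = transpose ?N"
    by (simp add: matrix_mul_assoc[symmetric] inv)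
  ultimately show ?thesis by simp
qed

lemma full_column_rank_gram_invertible:
  fixes D :: "real^'m^'r"
  assumes "rank D = CARD('m)"
  shows "invertible (transpose D ** D)"
proof -
  have inj: "inj ((*v) D)" using assms by (simp add: full_rank_injective)
  have "x = 0" if "(transpose D ** D) *v x = 0" for x
  proof -
    have "(D *v x) \<bullet> (D *v x) = x \<bullet> ((transpose D ** D) *v x)"
      by (simp add: matrix_vector_mul_assoc[symmetric] dot_lmul_matrix inner_commute[of x])
    hence "D *v x = D *v 0" using that by simp
    thus ?thesis using injD[OF inj] by blast
  qed
  hence "\<exists>B. B ** (transpose D ** D) = mat 1" by (subst matrix_left_invertible_ker) blast
  thus ?thesis by (simp add: invertible_left_inverse)
qed


section \<open>The Newton step\<close>

lemma stable_imp_no_unstable_eigenvector_complex: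
  fixes M A\<^sub>1 :: "real^'n^'n" and X :: "complex^'n^'n"
  assumes W: "brownian_motion \<Omega> F W" and stable: "brownian_motion.asymp_mean_square_stable \<Omega> F W M A\<^sub>1"
    and \<mu>: "0 \<le> Re \<mu>" and eig: "glyap (complexify M) (complexify A\<^sub>1) X = map_matrix ((*) \<mu>) X"
  shows "X = 0"
proof -
  interpret brownian_motion \<Omega> F W by (rule W)
  have "glyap M A\<^sub>1 (map_matrix Re X) = Re \<mu> *\<^sub>R map_matrix Re X - Im \<mu> *\<^sub>R map_matrix Im X"
    unfolding glyap_Re_Im[symmetric] eig by (simp add: vec_eq_iff)
  moreover have "glyap M A\<^sub>1 (map_matrix Im X) = Im \<mu> *\<^sub>R map_matrix Re X + Re \<mu> *\<^sub>R map_matrix Im X"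
    unfolding glyap_Re_Im[symmetric] eig by (simp add: vec_eq_iff)
  ultimately have "map_matrix Re X = 0 \<and> map_matrix Im X = 0"
    by (rule stable_imp_no_unstable_eigenvector[OF stable _ _ \<mu>])
  thus ?thesis by (simp add: vec_eq_iff complex_eq_iff)
qed

text \<open>
The update linearizes the Riccati equation at \<open>P\<close>. A quadratic map differs from its linearization
by its quadratic part alone, evaluated at the error.
\<close>

lemma newton_error_equation:
  fixes A A\<^sub>1 S Q P P' Pstar :: "real^'n^'n"
  assumes sym: "transpose S = S" "transpose P = P"
    and ric: "Pstar ** A + transpose A ** Pstar + transpose A\<^sub>1 ** Pstar ** A\<^sub>1 - Pstar ** S ** Pstar + Q = 0"
    and upd: "P' ** (A - S ** P) + transpose (A - S ** P) ** P' + transpose A\<^sub>1 ** P' ** A\<^sub>1 + Q + P ** S ** P = 0"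
  shows "glyap (A - S ** P) A\<^sub>1 (P' - Pstar) = - ((P - Pstar) ** S ** (P - Pstar))"
proof -
  interpret mm: bounded_bilinear "(**) :: real^'n^'n \<Rightarrow> _ \<Rightarrow> real^'n^'n"
    by (rule bounded_bilinear_matrix_mult)
  have tr: "transpose (A - S ** P) = transpose A - P ** S"
    using linear_diff[OF bounded_linear.linear[OF bounded_linear_transpose], of A "S ** P"]
    by (simp add: matrix_transpose_mul sym)
  have "glyap (A - S ** P) A\<^sub>1 (P' - Pstar) + (P - Pstar) ** S ** (P - Pstar) =
     (P' ** (A - S ** P) + transpose (A - S ** P) ** P' + transpose A\<^sub>1 ** P' ** A\<^sub>1 + Q + P ** S ** P)
     - (Pstar ** A + transpose A ** Pstar + transpose A\<^sub>1 ** Pstar ** A\<^sub>1 - Pstar ** S ** Pstar + Q)"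
    unfolding glyap_def tr
    by (simp add: mm.diff_left mm.diff_right matrix_mul_assoc)
  also have "\<dots> = 0" unfolding ric upd by simp
  finally show ?thesis by (simp add: eq_neg_iff_add_eq_0)
qed

theorem theorem2:
  fixes \<Omega> :: "'w measure" and F :: "real \<Rightarrow> 'w measure" and W :: "real \<Rightarrow> 'w \<Rightarrow> real"
    and A A\<^sub>1 :: "real^'n^'n" and B :: "real^'m^'n" and E :: "real^'p^'n"
    and C :: "real^'n^'q" and D :: "real^'m^'r" and Q :: "real^'n^'n" and R :: "real^'m^'m"
    and \<gamma> :: real and Pstar :: "real^'n^'n"
  assumes W: "brownian_motion \<Omega> F W"
    and D: "rank D = CARD('m)"
    and Q: "Q = transpose C ** C"
    and R: "R = transpose D ** D"
    and \<gamma>: "\<gamma> > 0"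
    and Pstar_psd: "psd Pstar"
    and Pstar_riccati:
      "Pstar ** A + transpose A ** Pstar + transpose A\<^sub>1 ** Pstar ** A\<^sub>1
         - Pstar ** B ** matrix_inv R ** transpose B ** Pstar
         + (1 / \<gamma>\<^sup>2) *\<^sub>R (Pstar ** E ** transpose E ** Pstar) + Q = 0"
    and Pstar_stabilizing:
      "brownian_motion.asymp_mean_square_stable \<Omega> F W (closed_loop A B R E \<gamma> Pstar) A\<^sub>1"
  shows "\<forall>\<epsilon>\<^sub>0::real. 0 < \<epsilon>\<^sub>0 \<and> \<epsilon>\<^sub>0 < 1 \<longrightarrow>
    (\<exists>\<delta>\<^sub>0>0. \<exists>k\<^sub>0>0. \<forall>(P :: nat \<Rightarrow> real^'n^'n) i. P i \<in> psd_ball \<delta>\<^sub>0 Pstar \<longrightarrow>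
      glyap_spectrum (closed_loop A B R E \<gamma> (P i)) A\<^sub>1 \<subseteq> open_left_half_plane \<and>
      (P (Suc i) ** closed_loop A B R E \<gamma> (P i)
         + transpose (closed_loop A B R E \<gamma> (P i)) ** P (Suc i)
         + transpose A\<^sub>1 ** P (Suc i) ** A\<^sub>1 + Q
         + P i ** B ** matrix_inv R ** transpose B ** P i
         - (1 / \<gamma>\<^sup>2) *\<^sub>R (P i ** E ** transpose E ** P i) = 0 \<longrightarrow>
       norm (P (Suc i) - Pstar) \<le> k\<^sub>0 * (norm (P i - Pstar))\<^sup>2 \<and>
       norm (P (Suc i) - Pstar) \<le> \<epsilon>\<^sub>0 * norm (P i - Pstar)))"
proof (intro allI impI)
  fix \<epsilon> :: real assume \<epsilon>: "0 < \<epsilon> \<and> \<epsilon> < 1"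
  interpret mm: bounded_bilinear "(**) :: real^'n^'n \<Rightarrow> _ \<Rightarrow> real^'n^'n"
    by (rule bounded_bilinear_matrix_mult)
  obtain K where K: "K > 0" "\<And>(X :: real^'n^'n) (Y :: real^'n^'n). norm (X ** Y) \<le> norm X * norm Y * K"
    using mm.pos_bounded by blast
  define S where "S = B ** matrix_inv R ** transpose B - (1 / \<gamma>\<^sup>2) *\<^sub>R (E ** transpose E)"
  have Rsym: "transpose (matrix_inv R) = matrix_inv R"
    using full_column_rank_gram_invertible[OF D]
    by (intro symmetric_matrix_inv) (simp_all add: R matrix_transpose_mul)
  have Ssym: "transpose S = S"
  proof -
    note lin = bounded_linear.linear[OF bounded_linear_transpose]
    show ?thesis
      unfolding S_def
      by (simp add: linear_diff[OF lin] linear_scale[OF lin] matrix_transpose_mul Rsym matrix_mul_assoc)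
  qed
  have cl: "closed_loop A B R E \<gamma> P = A - S ** P" for P
    by (simp add: closed_loop_def S_def mm.diff_left mm.scaleR_left)
  have quad: "P ** S ** P = P ** B ** matrix_inv R ** transpose B ** P
      - (1 / \<gamma>\<^sup>2) *\<^sub>R (P ** E ** transpose E ** P)" for P
    by (simp add: S_def mm.diff_left mm.diff_right mm.scaleR_left mm.scaleR_right matrix_mul_assoc)
  obtain m where m: "m > 0" "resolvent_bound (A - S ** Pstar) A\<^sub>1 m"
    using resolvent_bound_exists stable_imp_no_unstable_eigenvector_complex[OF W Pstar_stabilizing]
    unfolding cl by blast
  obtain \<eta> where \<eta>: "\<eta> > 0" "\<And>M'. norm (M' - (A - S ** Pstar)) \<le> \<eta> \<Longrightarrow> resolvent_bound M' A\<^sub>1 (m / 2)"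
    using resolvent_bound_perturb[OF m(2,1)] by blast
  (* The summand 1, here and in the next line, keeps the divisors positive when S = 0. *)
  define k where "k = 2 / m * (K\<^sup>2 * norm S) + 1"
  define \<delta> where "\<delta> = min (\<eta> / (K * norm S + 1)) (\<epsilon> / k)"
  have KS: "0 \<le> K * norm S" using K(1) by simp
  have k: "k > 0" unfolding k_def using K(1) m(1) by (intro add_nonneg_pos) auto
  have \<delta>: "\<delta> > 0" using \<eta>(1) k \<epsilon> KS by (auto simp: \<delta>_def intro!: divide_pos_pos)
  have main: "glyap_spectrum (A - S ** P) A\<^sub>1 \<subseteq> open_left_half_plane \<and>
      (P' ** (A - S ** P) + transpose (A - S ** P) ** P' + transpose A\<^sub>1 ** P' ** A\<^sub>1 + Q + P ** S ** P = 0 \<longrightarrow>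
       norm (P' - Pstar) \<le> k * (norm (P - Pstar))\<^sup>2 \<and> norm (P' - Pstar) \<le> \<epsilon> * norm (P - Pstar))"
    if P: "P \<in> psd_ball \<delta> Pstar" for P P'
  proof (intro conjI impI)
    define X where "X = P - Pstar"
    have X: "norm X \<le> \<delta>" and Psym: "transpose P = P" using P by (auto simp: psd_ball_def psd_def X_def)
    have "norm ((A - S ** P) - (A - S ** Pstar)) = norm (S ** X)"
      by (simp add: X_def mm.diff_right norm_minus_commute)
    also have "\<dots> \<le> norm S * norm X * K" by (rule K)
    also have "\<dots> \<le> (K * norm S + 1) * norm X" by (simp add: algebra_simps)
    also have "\<dots> \<le> (K * norm S + 1) * (\<eta> / (K * norm S + 1))"
      using X KS by (intro mult_left_mono) (auto simp: \<delta>_def)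
    also have "\<dots> = \<eta>" using KS by simp
    finally have rb: "resolvent_bound (A - S ** P) A\<^sub>1 (m / 2)" by (rule \<eta>(2))
    show "glyap_spectrum (A - S ** P) A\<^sub>1 \<subseteq> open_left_half_plane"
      using resolvent_bound_spectrum[OF rb] m(1) by simp
    assume upd: "P' ** (A - S ** P) + transpose (A - S ** P) ** P' + transpose A\<^sub>1 ** P' ** A\<^sub>1 + Q + P ** S ** P = 0"
    have "Pstar ** A + transpose A ** Pstar + transpose A\<^sub>1 ** Pstar ** A\<^sub>1 - Pstar ** S ** Pstar + Q = 0"
      using Pstar_riccati by (simp add: quad algebra_simps)
    from newton_error_equation[OF Ssym Psym this upd]
    have "m / 2 * norm (P' - Pstar) \<le> norm (X ** S ** X)"
      using resolvent_bound_glyap[OF rb, of "P' - Pstar"] by (simp add: X_def)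
    also have "\<dots> \<le> norm (X ** S) * norm X * K" by (rule K)
    also have "\<dots> \<le> (norm X * norm S * K) * norm X * K"
      by (rule mult_right_mono[OF mult_right_mono[OF K(2)]]) (use K(1) in auto)
    finally have "norm (P' - Pstar) \<le> 2 / m * (K\<^sup>2 * norm S) * (norm X)\<^sup>2"
      using m(1) by (simp add: field_simps power2_eq_square)
    also have "\<dots> \<le> k * (norm X)\<^sup>2" by (rule mult_right_mono) (auto simp: k_def)
    finally show quadratic: "norm (P' - Pstar) \<le> k * (norm (P - Pstar))\<^sup>2" by (simp add: X_def)
    have "k * norm X \<le> k * (\<epsilon> / k)" using X k by (intro mult_left_mono) (auto simp: \<delta>_def)
    hence "k * norm X \<le> \<epsilon>" using k by simp
    from mult_right_mono[OF this, of "norm X"]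
    have "k * (norm X)\<^sup>2 \<le> \<epsilon> * norm X" by (simp add: power2_eq_square mult.assoc)
    with quadratic show "norm (P' - Pstar) \<le> \<epsilon> * norm (P - Pstar)" by (simp add: X_def)
  qed
  show "\<exists>\<delta>\<^sub>0>0. \<exists>k\<^sub>0>0. \<forall>(P :: nat \<Rightarrow> real^'n^'n) i. P i \<in> psd_ball \<delta>\<^sub>0 Pstar \<longrightarrow>
      glyap_spectrum (closed_loop A B R E \<gamma> (P i)) A\<^sub>1 \<subseteq> open_left_half_plane \<and>
      (P (Suc i) ** closed_loop A B R E \<gamma> (P i)
         + transpose (closed_loop A B R E \<gamma> (P i)) ** P (Suc i)
         + transpose A\<^sub>1 ** P (Suc i) ** A\<^sub>1 + Q
         + P i ** B ** matrix_inv R ** transpose B ** P i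
         - (1 / \<gamma>\<^sup>2) *\<^sub>R (P i ** E ** transpose E ** P i) = 0 \<longrightarrow>
       norm (P (Suc i) - Pstar) \<le> k\<^sub>0 * (norm (P i - Pstar))\<^sup>2 \<and>
       norm (P (Suc i) - Pstar) \<le> \<epsilon> * norm (P i - Pstar))"
    using main \<delta> k unfolding cl quad add_diff_eq by blast
qed

end
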